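(* Let $\Phi\in\mathcal{S}^*(M)$ and $\Phi_n\in\mathcal{S}^*(M)$, $n\geq 1$, be generalized functionals of $M$. Then the sequence $(\Phi_n)_{n\ge 1}$ converges strongly to $\Phi$ in $\mathcal{S}^*(M)$ if and only if it satisfies both of the following conditions: (1) $\widehat{\Phi_n}(\sigma)\rightarrow\widehat{\Phi}(\sigma)$ as $n\to\infty$ for all $\sigma\in\Gamma$; (2) there are constants $C\geq 0$ and $p\geq 0$ such that $$\sup_{n\geq 1}|\widehat{\Phi_n}(\sigma)|\leq C\lambda_\sigma^p,\quad \sigma\in\Gamma.$$
   Context: $\mathbb{N}$ is the set of nonnegative integers and $\Gamma$ is the set of all finite subsets of $\mathbb{N}$. $(\Omega,\mathcal{F},P)$ is a probability space with expectation $\mathbb{E}$. A discrete-time normal martingale is a real-valued square integrable process $M=(M_n)_{n\in\mathbb{N}}$ on it such that $\mathbb{E}[M_0|\mathcal{F}_{-1}]=0$, $\mathbb{E}[M_n|\mathcal{F}_{n-1}]=M_{n-1}$ for $n\ge1$, $\mathbb{E}[M_0^2|\mathcal{F}_{-1}]=1$ and $\mathbb{E}[M_n^2|\mathcal{F}_{n-1}]=M_{n-1}^2+1$ for $n\ge1$, where $\mathcal{F}_{-1}=\{\emptyset,\Omega\}$ and $\mathcal{F}_n=\sigma(M_k;0\le k\le n)$. Its associated discrete-time normal noise is $Z_0=M_0$, $Z_n=M_n-M_{n-1}$ ($n\ge 1$). Put $Z_\emptyset=1$ and $Z_\sigma=\prod_{i\in\sigma}Z_i$ for nonempty $\sigma\in\Gamma$.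 Let $\mathcal{F}_\infty=\sigma(M_n;n\in\mathbb{N})$ and let $\mathcal{L}^2(M)=\mathcal{L}^2(\Omega,\mathcal{F}_\infty,P)$ be the complex Hilbert space with inner product $\langle\cdot,\cdot\rangle$ (conjugate-linear in the first argument, linear in the second) and norm $\|\cdot\|$. $M$ has the chaotic representation property if $\{Z_\sigma\mid\sigma\in\Gamma\}$ is total in $\mathcal{L}^2(M)$. Standing assumption: $M$ is a discrete-time normal martingale with the chaotic representation property; then $\{Z_\sigma\mid\sigma\in\Gamma\}$ is an orthonormal basis of $\mathcal{L}^2(M)$. Let $\lambda_\emptyset=1$ and $\lambda_\sigma=\prod_{k\in\sigma}(k+1)$ for nonempty $\sigma\in\Gamma$. For $p\ge0$ put $\|\xi\|_p^2=\sum_{\sigma\in\Gamma}\lambda_\sigma^{2p}|\langle Z_\sigma,\xi\rangle|^2$ and $\mathcal{S}_p(M)=\{\xi\in\mathcal{L}^2(M)\mid\|\xi\|_p<\infty\}$, a Hilbert space with norm $\|\cdot\|_p$. Let $\mathcal{S}(M)=\bigcap_{p=0}^\infty\mathcal{S}_p(M)$ with the topology generated by the norms $\{\|\cdot\|_p\}_{p\ge0}$; it contains all $Z_\sigma$. $\mathcal{S}^*(M)$ is the topological dual of $\mathcal{S}(M)$; its elements are called generalized functionals of $M$. The canonical bilinear form is $\langle\!\langle\Phi,\xi\rangle\!\rangle=\Phi(\xi)$ for $\Phi\in\mathcal{S}^*(M)$, $\xi\in\mathcal{S}(M)$. Strong convergence in $\mathcal{S}^*(M)$ means convergence in the strong topology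 (uniform convergence on bounded subsets of $\mathcal{S}(M)$). The Fock transform of $\Phi\in\mathcal{S}^*(M)$ is the function $\widehat{\Phi}$ on $\Gamma$ given by $\widehat{\Phi}(\sigma)=\langle\!\langle\Phi,Z_\sigma\rangle\!\rangle$. *)

theory Defs
  imports "HOL-Probability.Probability"
begin

abbreviation Fin_sets :: "nat set set"  (\<open>\<Gamma>\<close>)
  where "\<Gamma> \<equiv> {\<sigma>. finite \<sigma>}"

section \<open>Discrete-time normal martingales\<close>

text \<open>The sigma-algebra generated by \<open>M k\<close>, \<open>k \<in> I\<close>, so that \<open>natural_algebra P M {..n}\<close> is
  \<open>\<F>\<^sub>n\<close> and \<open>natural_algebra P M UNIV\<close> is \<open>\<F>\<^sub>\<infinity>\<close>.
  Only its space and its measurable sets matter; the measure is always that of \<open>P\<close>.\<close>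

definition natural_algebra :: "'a measure \<Rightarrow> (nat \<Rightarrow> 'a \<Rightarrow> real) \<Rightarrow> nat set \<Rightarrow> 'a measure"
  where "natural_algebra P M I =
    sigma (space P) {M k -` A \<inter> space P | k A. k \<in> I \<and> A \<in> sets borel}"

definition trivial_algebra :: "'a measure \<Rightarrow> 'a measure"
  where "trivial_algebra P = sigma (space P) {{}, space P}"

definition normal_martingale :: "'a measure \<Rightarrow> (nat \<Rightarrow> 'a \<Rightarrow> real) \<Rightarrow> bool"
  where "normal_martingale P M \<longleftrightarrow>
    (\<forall>n. M n \<in> borel_measurable P \<and> integrable P (\<lambda>\<omega>. (M n \<omega>)\<^sup>2)) \<and>
    (AE \<omega> in P. real_cond_exp P (trivial_algebra P) (M 0) \<omega> = 0) \<and>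
    (\<forall>n\<ge>1. AE \<omega> in P.
       real_cond_exp P (natural_algebra P M {..n - 1}) (M n) \<omega> = M (n - 1) \<omega>) \<and>
    (AE \<omega> in P. real_cond_exp P (trivial_algebra P) (\<lambda>\<omega>. (M 0 \<omega>)\<^sup>2) \<omega> = 1) \<and>
    (\<forall>n\<ge>1. AE \<omega> in P.
       real_cond_exp P (natural_algebra P M {..n - 1}) (\<lambda>\<omega>. (M n \<omega>)\<^sup>2) \<omega>
         = (M (n - 1) \<omega>)\<^sup>2 + 1)"

definition noise :: "(nat \<Rightarrow> 'a \<Rightarrow> real) \<Rightarrow> nat \<Rightarrow> 'a \<Rightarrow> real"
  where "noise M n \<omega> = (if n = 0 then M 0 \<omega> else M n \<omega> - M (n - 1) \<omega>)"

definition noise_prod :: "(nat \<Rightarrow> 'a \<Rightarrow> real) \<Rightarrow> nat set \<Rightarrow> 'a \<Rightarrow> complex"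
  where "noise_prod M \<sigma> \<omega> = complex_of_real (\<Prod>i\<in>\<sigma>. noise M i \<omega>)"

text \<open>The elements of \<open>\<L>\<^sup>2(M)\<close> are given by representatives, that is, by square integrable
  functions that are not identified when they agree almost everywhere. All the norms below are thus
  seminorms that depend on the class of a function only, and a continuous functional takes the same
  value on equivalent functions (see \<open>gen_functionals_cong_AE\<close>).\<close>

definition L2 :: "'a measure \<Rightarrow> (nat \<Rightarrow> 'a \<Rightarrow> real) \<Rightarrow> ('a \<Rightarrow> complex) set"
  where "L2 P M = {f \<in> borel_measurable (natural_algebra P M UNIV).
                     integrable P (\<lambda>\<omega>. (cmod (f \<omega>))\<^sup>2)}"

definition L2_inner :: "'a measure \<Rightarrow> ('a \<Rightarrow> complex) \<Rightarrow> ('a \<Rightarrow> complex) \<Rightarrow> complex"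
  where "L2_inner P f g = (\<integral>\<omega>. cnj (f \<omega>) * g \<omega> \<partial>P)"

definition L2_norm :: "'a measure \<Rightarrow> ('a \<Rightarrow> complex) \<Rightarrow> real"
  where "L2_norm P f = sqrt (\<integral>\<omega>. (cmod (f \<omega>))\<^sup>2 \<partial>P)"

text \<open>Totality: the finite complex linear combinations of the \<open>Z\<^sub>\<sigma>\<close> are dense.\<close>

definition chaotic_representation :: "'a measure \<Rightarrow> (nat \<Rightarrow> 'a \<Rightarrow> real) \<Rightarrow> bool"
  where "chaotic_representation P M \<longleftrightarrow>
    (\<forall>\<xi>\<in>L2 P M. \<forall>\<epsilon>>0. \<exists>A c. finite A \<and> A \<subseteq> \<Gamma> \<and>
       L2_norm P (\<lambda>\<omega>. \<xi> \<omega> - (\<Sum>\<sigma>\<in>A. c \<sigma> * noise_prod M \<sigma> \<omega>)) < \<epsilon>)"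

section \<open>Testing and generalized functionals\<close>

definition weight :: "nat set \<Rightarrow> real"
  where "weight \<sigma> = (\<Prod>k\<in>\<sigma>. real k + 1)"

definition Sp :: "'a measure \<Rightarrow> (nat \<Rightarrow> 'a \<Rightarrow> real) \<Rightarrow> real \<Rightarrow> ('a \<Rightarrow> complex) set"
  where "Sp P M p = {\<xi> \<in> L2 P M.
    (\<lambda>\<sigma>. weight \<sigma> powr (2 * p) * (cmod (L2_inner P (noise_prod M \<sigma>) \<xi>))\<^sup>2) summable_on \<Gamma>}"

definition Sp_norm :: "'a measure \<Rightarrow> (nat \<Rightarrow> 'a \<Rightarrow> real) \<Rightarrow> real \<Rightarrow> ('a \<Rightarrow> complex) \<Rightarrow> real"
  where "Sp_norm P M p \<xi> = sqrt (\<Sum>\<^sub>\<infinity>\<sigma>\<in>\<Gamma>.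
    weight \<sigma> powr (2 * p) * (cmod (L2_inner P (noise_prod M \<sigma>) \<xi>))\<^sup>2)"

definition testing_functionals :: "'a measure \<Rightarrow> (nat \<Rightarrow> 'a \<Rightarrow> real) \<Rightarrow> ('a \<Rightarrow> complex) set"
  where "testing_functionals P M = (\<Inter>p::nat. Sp P M (real p))"

definition testing_topology ::
    "'a measure \<Rightarrow> (nat \<Rightarrow> 'a \<Rightarrow> real) \<Rightarrow> ('a \<Rightarrow> complex) topology"
  where "testing_topology P M = topology_generated_by
    {{\<eta> \<in> testing_functionals P M. Sp_norm P M p (\<lambda>\<omega>. \<eta> \<omega> - \<xi> \<omega>) < \<epsilon>} | \<xi> p \<epsilon>.
       \<xi> \<in> testing_functionals P M \<and> p \<ge> 0 \<and> \<epsilon> > 0}"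

text \<open>The topological dual; a functional is \<open>undefined\<close> outside \<open>\<S>(M)\<close>.\<close>

definition gen_functionals ::
    "'a measure \<Rightarrow> (nat \<Rightarrow> 'a \<Rightarrow> real) \<Rightarrow> (('a \<Rightarrow> complex) \<Rightarrow> complex) set"
  where "gen_functionals P M = {\<Phi> \<in> extensional (testing_functionals P M).
    (\<forall>\<xi>\<in>testing_functionals P M. \<forall>\<eta>\<in>testing_functionals P M.
       \<Phi> (\<lambda>\<omega>. \<xi> \<omega> + \<eta> \<omega>) = \<Phi> \<xi> + \<Phi> \<eta>) \<and>
    (\<forall>c. \<forall>\<xi>\<in>testing_functionals P M. \<Phi> (\<lambda>\<omega>. c * \<xi> \<omega>) = c * \<Phi> \<xi>) \<and>
    continuous_map (testing_topology P M) euclidean \<Phi>}"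

text \<open>Boundedness in the sense of topological vector spaces: absorbed by every neighbourhood of
  zero.\<close>

definition testing_bounded ::
    "'a measure \<Rightarrow> (nat \<Rightarrow> 'a \<Rightarrow> real) \<Rightarrow> ('a \<Rightarrow> complex) set \<Rightarrow> bool"
  where "testing_bounded P M B \<longleftrightarrow> B \<subseteq> testing_functionals P M \<and>
    (\<forall>U. openin (testing_topology P M) U \<and> (\<lambda>\<omega>. 0) \<in> U \<longrightarrow>
       (\<exists>r::real. r > 0 \<and> B \<subseteq> (\<lambda>\<xi> \<omega>. complex_of_real r * \<xi> \<omega>) ` U))"

definition converges_strongly ::
    "'a measure \<Rightarrow> (nat \<Rightarrow> 'a \<Rightarrow> real) \<Rightarrow> (nat \<Rightarrow> ('a \<Rightarrow> complex) \<Rightarrow> complex) \<Rightarrow>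
      (('a \<Rightarrow> complex) \<Rightarrow> complex) \<Rightarrow> bool"
  where "converges_strongly P M \<Phi>s \<Phi> \<longleftrightarrow>
    (\<forall>B. testing_bounded P M B \<longrightarrow> uniform_limit B \<Phi>s \<Phi> sequentially)"

definition fock_transform ::
    "(nat \<Rightarrow> 'a \<Rightarrow> real) \<Rightarrow> (('a \<Rightarrow> complex) \<Rightarrow> complex) \<Rightarrow> nat set \<Rightarrow> complex"
  where "fock_transform M \<Phi> \<sigma> = \<Phi> (noise_prod M \<sigma>)"

section \<open>Functionals depend on equivalence classes only\<close>

lemma noise_prod_measurable:
  assumes "normal_martingale P M"
  shows "noise_prod M \<sigma> \<in> borel_measurable P"
proof -
  have M: "M n \<in> borel_measurable P" for n
    using assms by (simp add: normal_martingale_def)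
  note [measurable] = this
  have [measurable]: "noise M n \<in> borel_measurable P" for n
    unfolding noise_def [abs_def] by (cases "n = 0") simp_all
  have "(\<lambda>\<omega>. \<Prod>i\<in>\<sigma>. noise M i \<omega>) \<in> borel_measurable P"
    by (rule borel_measurable_prod) measurable
  from measurable_compose [OF this borel_measurable_of_real] show ?thesis
    unfolding noise_prod_def [abs_def] .
qed

lemma L2_measurable:
  assumes "normal_martingale P M" "f \<in> L2 P M"
  shows "f \<in> borel_measurable P"
proof -
  let ?G = "{M k -` A \<inter> space P | k A. k \<in> UNIV \<and> A \<in> sets borel}"
  have "M k \<in> borel_measurable P" for k
    using assms(1) by (simp add: normal_martingale_def)
  then have G: "?G \<subseteq> sets P"
    using measurable_sets by blast
  then have "?G \<subseteq> Pow (space P)"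
    using sets.sets_into_space by blast
  with G have "subalgebra P (natural_algebra P M UNIV)"
    by (simp only: subalgebra_def natural_algebra_def sets_measure_of space_measure_of
        sets.sigma_sets_subset simp_thms)
  then show ?thesis
    using assms(2) unfolding L2_def by (blast intro: measurable_from_subalg)
qed

lemma gen_functionals_cong_AE:
  assumes M: "normal_martingale P M" and \<Phi>: "\<Phi> \<in> gen_functionals P M"
    and \<xi>: "\<xi> \<in> testing_functionals P M" and \<eta>: "\<eta> \<in> testing_functionals P M"
    and ae: "AE \<omega> in P. \<xi> \<omega> = \<eta> \<omega>"
  shows "\<Phi> \<xi> = \<Phi> \<eta>"
proof -
  have meas: "f \<in> borel_measurable P" if "f \<in> testing_functionals P M" for f
    using that L2_measurable [OF M] by (auto simp: testing_functionals_def Sp_def)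
  have norm_eq: "Sp_norm P M p (\<lambda>\<omega>. \<xi> \<omega> - \<zeta> \<omega>) = Sp_norm P M p (\<lambda>\<omega>. \<eta> \<omega> - \<zeta> \<omega>)"
    if "\<zeta> \<in> testing_functionals P M" for p \<zeta>
  proof -
    have cnj: "cnj (noise_prod M \<sigma> \<omega>) = noise_prod M \<sigma> \<omega>" for \<sigma> \<omega>
      by (simp add: noise_prod_def)
    note [measurable] = meas [OF \<xi>] meas [OF \<eta>] meas [OF that] noise_prod_measurable [OF M]
    have "L2_inner P (noise_prod M \<sigma>) (\<lambda>\<omega>. \<xi> \<omega> - \<zeta> \<omega>)
        = L2_inner P (noise_prod M \<sigma>) (\<lambda>\<omega>. \<eta> \<omega> - \<zeta> \<omega>)" for \<sigma>
      unfolding L2_inner_def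
    proof (rule integral_cong_AE)
      show "AE \<omega> in P. cnj (noise_prod M \<sigma> \<omega>) * (\<xi> \<omega> - \<zeta> \<omega>)
          = cnj (noise_prod M \<sigma> \<omega>) * (\<eta> \<omega> - \<zeta> \<omega>)"
        using ae by eventually_elim simp
    qed (simp_all add: cnj)
    then show ?thesis by (simp add: Sp_norm_def)
  qed
  let ?T = "{{\<eta> \<in> testing_functionals P M. Sp_norm P M p (\<lambda>\<omega>. \<eta> \<omega> - \<zeta> \<omega>) < \<epsilon>} | \<zeta> p \<epsilon>.
               \<zeta> \<in> testing_functionals P M \<and> p \<ge> 0 \<and> \<epsilon> > 0}"
  have indist: "\<xi> \<in> U \<longleftrightarrow> \<eta> \<in> U" if "openin (testing_topology P M) U" for U
  proof -
    have "generate_topology_on ?T U"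
      using that by (simp add: testing_topology_def openin_topology_generated_by_iff)
    then show ?thesis
    proof induction
      case (Basis S)
      then obtain \<zeta> p \<epsilon> where \<zeta>: "\<zeta> \<in> testing_functionals P M"
        and S: "S = {\<eta> \<in> testing_functionals P M. Sp_norm P M p (\<lambda>\<omega>. \<eta> \<omega> - \<zeta> \<omega>) < \<epsilon>}"
        by blast
      show ?case
        unfolding S using \<xi> \<eta> norm_eq [OF \<zeta>, of p] by simp
    qed blast+
  qed
  have top: "f \<in> topspace (testing_topology P M)" if f: "f \<in> testing_functionals P M" for f
  proof -
    have "Sp_norm P M 0 (\<lambda>\<omega>. f \<omega> - f \<omega>) < 1"
      by (simp add: Sp_norm_def L2_inner_def)
    then have "f \<in> {\<eta> \<in> testing_functionals P M. Sp_norm P M 0 (\<lambda>\<omega>. \<eta> \<omega> - f \<omega>) < 1}"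
      using f by blast
    moreover have "{\<eta> \<in> testing_functionals P M. Sp_norm P M 0 (\<lambda>\<omega>. \<eta> \<omega> - f \<omega>) < 1} \<in> ?T"
      using f zero_less_one order_refl [of "0::real"] by blast
    ultimately show ?thesis
      unfolding testing_topology_def topology_generated_by_topspace by (rule UnionI [rotated])
  qed
  have "continuous_map (testing_topology P M) euclidean \<Phi>"
    using \<Phi> by (simp add: gen_functionals_def)
  then have "openin (testing_topology P M) {f \<in> topspace (testing_topology P M). \<Phi> f \<in> - {\<Phi> \<xi>}}"
    by (rule openin_continuous_map_preimage) (simp add: open_Compl)
  from indist [OF this] show ?thesis
    using top \<xi> \<eta> by auto
qed

end

theory Submission
  imports Defs
begin

text \<open>
  Orthonormality of the \<open>Z\<^sub>\<sigma>\<close> turns \<open>\<S>(M)\<close> into a space of rapidly decreasing coefficient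
  families: since all seminorms depend on the coefficients only, the partial sums of the expansion
  of \<open>\<xi>\<close> converge in \<open>\<S>(M)\<close>, and a continuous functional satisfies
  \<open>\<Phi> \<xi> = (\<Sum>\<sigma>. \<langle>Z\<^sub>\<sigma>, \<xi>\<rangle> * \<Phi> Z\<^sub>\<sigma>)\<close>. A bounded set of test functionals has
  coefficients \<open>O(\<lambda>\<^sub>\<sigma> powr - q)\<close> for every \<open>q\<close>, and \<open>\<lambda>\<^sub>\<sigma> powr - 2\<close> is summable, so a
  polynomial bound on the Fock transforms and pointwise convergence give uniform convergence on
  bounded sets by dominated convergence. Conversely, if no polynomial bound exists, suitably
  rescaled \<open>Z\<^sub>\<sigma>\<close> form a bounded set on which the functionals are unbounded, which contradicts
  uniform convergence; no Baire category argument is needed.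
\<close>

section \<open>Orthonormality of the noise products\<close>

lemma integrable_mult_square_integrable:
  fixes f g :: "'a \<Rightarrow> 'b::{second_countable_topology,banach,real_normed_div_algebra}"
  assumes [measurable]: "f \<in> borel_measurable P" "g \<in> borel_measurable P"
    and "integrable P (\<lambda>\<omega>. (norm (f \<omega>))\<^sup>2)" "integrable P (\<lambda>\<omega>. (norm (g \<omega>))\<^sup>2)"
  shows "integrable P (\<lambda>\<omega>. f \<omega> * g \<omega>)"
proof (rule Bochner_Integration.integrable_bound)
  show "integrable P (\<lambda>\<omega>. (norm (f \<omega>))\<^sup>2 + (norm (g \<omega>))\<^sup>2)"
    using assms by simp
  have "norm (f \<omega>) * norm (g \<omega>) \<le> (norm (f \<omega>))\<^sup>2 + (norm (g \<omega>))\<^sup>2" for \<omega>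
    using sum_squares_bound [of "norm (f \<omega>)" "norm (g \<omega>)"]
      mult_nonneg_nonneg [OF norm_ge_zero norm_ge_zero, of "f \<omega>" "g \<omega>"] by linarith
  then show "AE \<omega> in P. norm (f \<omega> * g \<omega>) \<le> norm ((norm (f \<omega>))\<^sup>2 + (norm (g \<omega>))\<^sup>2)"
    by (simp add: norm_mult)
qed simp

lemma integrable_mult_square_integrable_real:
  fixes f g :: "'a \<Rightarrow> real"
  assumes "f \<in> borel_measurable P" "g \<in> borel_measurable P"
    and "integrable P (\<lambda>\<omega>. (f \<omega>)\<^sup>2)" "integrable P (\<lambda>\<omega>. (g \<omega>)\<^sup>2)"
  shows "integrable P (\<lambda>\<omega>. f \<omega> * g \<omega>)"
  using integrable_mult_square_integrable [of f P g] assms by simp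

text \<open>The usual identity for \<open>real_cond_exp\<close> presupposes the integrability that
  is claimed here. For nonnegative functions \<open>nn_cond_exp\<close> satisfies E[f g] = E[f
  E[g|F]] with values in [0, infinity], and the right-hand side is E[f].\<close>

lemma (in sigma_finite_subalgebra) integrable_mult_cond_exp_eq_1:
  assumes f [measurable]: "f \<in> borel_measurable F" and g [measurable]: "g \<in> borel_measurable M"
    and nonneg: "\<And>x. f x \<ge> 0" "\<And>x. g x \<ge> 0"
    and one: "AE x in M. real_cond_exp M F g x = 1" and int: "integrable M f"
  shows "integrable M (\<lambda>x. f x * g x)"
proof (rule integrableI_nonneg)
  have [measurable]: "f \<in> borel_measurable M"
    using f subalg by (rule measurable_from_subalg [rotated])
  \<comment> \<open>\<open>real_cond_exp\<close> is the difference of the conditional expectations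
    of the positive and the negative part; the latter is zero because g is nonnegative.\<close>
  have "AE x in M. nn_cond_exp M F (\<lambda>x. ennreal (- g x)) x = 0"
    using nn_cond_exp_F_meas [of "\<lambda>_. 0"] nonneg
    by (auto simp: ennreal_neg elim: eventually_mono)
  \<comment> \<open>\<open>enn2real\<close> maps infinity to 0, so the value 1 excludes
    infinity.\<close>
  moreover have "y = 1" if "enn2real y = 1" for y
    using that by (cases y) auto
  ultimately have "AE x in M. nn_cond_exp M F (\<lambda>x. ennreal (g x)) x = 1"
    using one unfolding real_cond_exp_def by (auto elim: AE_mp)
  then have "(\<integral>\<^sup>+ x. ennreal (f x) * nn_cond_exp M F (\<lambda>x. ennreal (g x)) x \<partial>M)
      = (\<integral>\<^sup>+ x. ennreal (f x) \<partial>M)"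
    by (intro nn_integral_cong_AE) auto
  then show "(\<integral>\<^sup>+ x. ennreal (f x * g x) \<partial>M) < \<infinity>"
    using int nonneg by (simp add: nn_cond_exp_intg ennreal_mult integrable_iff_bounded)
  show "(\<lambda>x. f x * g x) \<in> borel_measurable M" by measurable
qed (simp add: nonneg)

lemma subalgebra_sigma_preimages:
  assumes "\<And>k. M k \<in> borel_measurable P"
  shows "subalgebra P (natural_algebra P M I)"
proof -
  have "{M k -` A \<inter> space P | k A. k \<in> I \<and> A \<in> sets borel} \<subseteq> sets P"
    using assms measurable_sets by blast
  moreover from this have "{M k -` A \<inter> space P | k A. k \<in> I \<and> A \<in> sets borel} \<subseteq> Pow (space P)"
    using sets.sets_into_space by blast
  ultimately show ?thesis
    by (simp only: subalgebra_def natural_algebra_def sets_measure_of space_measure_of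
        sets.sigma_sets_subset simp_thms)
qed

lemma measurable_natural_algebra:
  assumes "k \<in> I"
  shows "M k \<in> borel_measurable (natural_algebra P M I)"
  unfolding natural_algebra_def
proof (rule measurableI)
  fix A :: "real set" assume "A \<in> sets borel"
  with assms show "M k -` A \<inter> space (sigma (space P) {M k -` A \<inter> space P | k A. k \<in> I \<and> A \<in> sets borel})
     \<in> sets (sigma (space P) {M k -` A \<inter> space P | k A. k \<in> I \<and> A \<in> sets borel})"
    by (subst sets_measure_of) (auto simp: space_measure_of_conv intro!: sigma_sets.Basic)
qed simp

section \<open>Conditional moments of the noise given its past\<close>

locale normal_martingale_space = prob_space P for P :: "'a measure" +
  fixes M :: "nat \<Rightarrow> 'a \<Rightarrow> real"
  assumes normal: "normal_martingale P M"
begin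

text \<open>This is the sigma-algebra with index n - 1 of the filtration. The case n = 0 is separate
  because \<open>0 - 1 = 0\<close> on naturals would put \<open>M 0\<close> into its own
  past.\<close>

definition past :: "nat \<Rightarrow> 'a measure"
  where "past n = (if n = 0 then trivial_algebra P else natural_algebra P M {..n - 1})"

lemma M_measurable [measurable]: "M n \<in> borel_measurable P"
  and M_square_integrable: "integrable P (\<lambda>\<omega>. (M n \<omega>)\<^sup>2)"
  using normal by (auto simp: normal_martingale_def)

lemma M_integrable: "integrable P (M n)"
  using M_measurable M_square_integrable by (rule square_integrable_imp_integrable)

lemma noise_measurable [measurable]: "noise M n \<in> borel_measurable P"
  unfolding noise_def [abs_def] by (cases "n = 0") simp_all

lemma subalgebra_past: "subalgebra P (past n)"
proof -
  have "subalgebra P (trivial_algebra P)"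
    unfolding trivial_algebra_def subalgebra_def
    by (simp add: sets_measure_of space_measure_of sets.sigma_sets_subset)
  then show ?thesis
    using subalgebra_sigma_preimages [of M P] M_measurable by (simp add: past_def)
qed

lemma sigma_finite_subalgebra_past: "sigma_finite_subalgebra P (past n)"
  using subalgebra_past
  by (intro finite_measure_subalgebra_is_sigma_finite finite_measure_subalgebra.intro
      finite_measure_subalgebra_axioms.intro finite_measure_axioms)

lemma M_measurable_past: "k < n \<Longrightarrow> M k \<in> borel_measurable (past n)"
  by (auto simp: past_def intro!: measurable_natural_algebra)

lemma cond_exp_noise: "AE \<omega> in P. real_cond_exp P (past n) (noise M n) \<omega> = 0"
proof (cases "n = 0")
  case True
  then show ?thesis
    using normal by (simp add: normal_martingale_def past_def noise_def [abs_def])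
next
  case False
  interpret sigma_finite_subalgebra P "past n" by (rule sigma_finite_subalgebra_past)
  have "AE \<omega> in P. real_cond_exp P (past n) (M n) \<omega> = M (n - 1) \<omega>"
    using normal False by (simp add: normal_martingale_def past_def)
  moreover have "AE \<omega> in P. real_cond_exp P (past n) (M (n - 1)) \<omega> = M (n - 1) \<omega>"
    using False by (intro real_cond_exp_F_meas M_integrable M_measurable_past) simp
  moreover have "AE \<omega> in P. real_cond_exp P (past n) (\<lambda>\<omega>. M n \<omega> - M (n - 1) \<omega>) \<omega>
      = real_cond_exp P (past n) (M n) \<omega> - real_cond_exp P (past n) (M (n - 1)) \<omega>"
    by (intro real_cond_exp_diff M_integrable)
  ultimately have "AE \<omega> in P. real_cond_exp P (past n) (\<lambda>\<omega>. M n \<omega> - M (n - 1) \<omega>) \<omega> = 0"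
    by eventually_elim simp
  then show ?thesis
    using False by (simp add: noise_def [abs_def])
qed

text \<open>Expand the square of M_n - M_{n-1}. In the cross term the factor M_{n-1} is known from
  the past and can be pulled out, so with m = M_{n-1} the conditional expectation is (m^2 + 1) - 2
  m^2 + m^2 = 1.\<close>

lemma cond_exp_noise_square:
  "AE \<omega> in P. real_cond_exp P (past n) (\<lambda>\<omega>. (noise M n \<omega>)\<^sup>2) \<omega> = 1"
proof (cases "n = 0")
  case True
  then show ?thesis
    using normal by (simp add: normal_martingale_def past_def noise_def [abs_def])
next
  case False
  interpret sigma_finite_subalgebra P "past n" by (rule sigma_finite_subalgebra_past)
  note past = M_measurable_past [of "n - 1" n]
  \<comment> \<open>Pulling out the known factor requires the product to be integrable, which holds
    since both factors are square integrable.\<close>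
  have int: "integrable P (\<lambda>\<omega>. (- 2 * M (n - 1) \<omega>) * M n \<omega>)"
    using integrable_mult_square_integrable_real [OF M_measurable M_measurable
        M_square_integrable M_square_integrable, of "n - 1" n]
      integrable_mult_right [of "- 2 :: real" P "\<lambda>\<omega>. M (n - 1) \<omega> * M n \<omega>"]
    by (simp add: mult.assoc)
  have "AE \<omega> in P. real_cond_exp P (past n) (\<lambda>\<omega>. (M n \<omega>)\<^sup>2) \<omega> = (M (n - 1) \<omega>)\<^sup>2 + 1"
    "AE \<omega> in P. real_cond_exp P (past n) (M n) \<omega> = M (n - 1) \<omega>"
    using normal False by (simp_all add: normal_martingale_def past_def)
  moreover have "AE \<omega> in P. real_cond_exp P (past n) (\<lambda>\<omega>. (- 2 * M (n - 1) \<omega>) * M n \<omega>) \<omega>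
      = (- 2 * M (n - 1) \<omega>) * real_cond_exp P (past n) (M n) \<omega>"
    using False past int by (intro real_cond_exp_mult) simp_all
  moreover have "AE \<omega> in P. real_cond_exp P (past n) (\<lambda>\<omega>. (M (n - 1) \<omega>)\<^sup>2) \<omega> = (M (n - 1) \<omega>)\<^sup>2"
    using False past by (intro real_cond_exp_F_meas M_square_integrable) simp
  moreover have "AE \<omega> in P. real_cond_exp P (past n)
        (\<lambda>\<omega>. ((M n \<omega>)\<^sup>2 + (- 2 * M (n - 1) \<omega>) * M n \<omega>) + (M (n - 1) \<omega>)\<^sup>2) \<omega>
      = real_cond_exp P (past n) (\<lambda>\<omega>. (M n \<omega>)\<^sup>2 + (- 2 * M (n - 1) \<omega>) * M n \<omega>) \<omega>
        + real_cond_exp P (past n) (\<lambda>\<omega>. (M (n - 1) \<omega>)\<^sup>2) \<omega>"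
    using int by (intro real_cond_exp_add Bochner_Integration.integrable_add M_square_integrable)
  moreover have "AE \<omega> in P. real_cond_exp P (past n) (\<lambda>\<omega>. (M n \<omega>)\<^sup>2 + (- 2 * M (n - 1) \<omega>) * M n \<omega>) \<omega>
      = real_cond_exp P (past n) (\<lambda>\<omega>. (M n \<omega>)\<^sup>2) \<omega>
        + real_cond_exp P (past n) (\<lambda>\<omega>. (- 2 * M (n - 1) \<omega>) * M n \<omega>) \<omega>"
    using int by (intro real_cond_exp_add M_square_integrable)
  ultimately have "AE \<omega> in P. real_cond_exp P (past n)
        (\<lambda>\<omega>. ((M n \<omega>)\<^sup>2 + (- 2 * M (n - 1) \<omega>) * M n \<omega>) + (M (n - 1) \<omega>)\<^sup>2) \<omega> = 1"
    by eventually_elim (simp add: power2_eq_square)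
  moreover have "(noise M n \<omega>)\<^sup>2
      = ((M n \<omega>)\<^sup>2 + (- 2 * M (n - 1) \<omega>) * M n \<omega>) + (M (n - 1) \<omega>)\<^sup>2" for \<omega>
    using False by (simp add: noise_def power2_diff algebra_simps)
  ultimately show ?thesis
    by (simp only:)
qed

text \<open>The real-valued form of \<open>noise_prod\<close>, since \<open>real_cond_exp\<close>
  acts on real functions only.\<close>

definition rprod :: "nat set \<Rightarrow> 'a \<Rightarrow> real"
  where "rprod \<sigma> \<omega> = (\<Prod>i\<in>\<sigma>. noise M i \<omega>)"

lemma rprod_insert: "finite \<sigma> \<Longrightarrow> n \<notin> \<sigma> \<Longrightarrow> rprod (insert n \<sigma>) = (\<lambda>\<omega>. noise M n \<omega> * rprod \<sigma> \<omega>)"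
  by (simp add: rprod_def fun_eq_iff)

lemma rprod_measurable [measurable]: "rprod \<sigma> \<in> borel_measurable P"
  unfolding rprod_def [abs_def] by (intro borel_measurable_prod noise_measurable)

lemma rprod_measurable_past:
  assumes "\<sigma> \<subseteq> {..<n}"
  shows "rprod \<sigma> \<in> borel_measurable (past n)"
proof -
  have "noise M i \<in> borel_measurable (past n)" if "i < n" for i
    using that M_measurable_past [of i n] M_measurable_past [of "i - 1" n]
    by (cases "i = 0") (simp_all add: noise_def [abs_def])
  with assms show ?thesis
    unfolding rprod_def [abs_def] by (intro borel_measurable_prod) auto
qed

text \<open>Square integrability of the single factors is not enough for that of their product.
  Splitting off the largest index n leaves a factor measurable with respect to
  \<open>past n\<close>, and the square of the n-th noise has conditional expectation 1 given that
  past.\<close>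

lemma rprod_square_integrable:
  assumes "finite \<sigma>"
  shows "integrable P (\<lambda>\<omega>. (rprod \<sigma> \<omega>)\<^sup>2)"
  using assms
proof (induction \<sigma> rule: finite_linorder_max_induct)
  case empty
  show ?case by (simp add: rprod_def)
next
  case (insert n \<sigma>)
  interpret sigma_finite_subalgebra P "past n" by (rule sigma_finite_subalgebra_past)
  have "rprod \<sigma> \<in> borel_measurable (past n)"
    using insert by (intro rprod_measurable_past) auto
  then have "integrable P (\<lambda>\<omega>. (rprod \<sigma> \<omega>)\<^sup>2 * (noise M n \<omega>)\<^sup>2)"
    using insert cond_exp_noise_square by (intro integrable_mult_cond_exp_eq_1) simp_all
  moreover have "n \<notin> \<sigma>" using insert by auto
  ultimately show ?case
    using insert by (simp add: rprod_insert power_mult_distrib mult.commute)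
qed

lemma rprod_mult_integrable:
  assumes "finite \<sigma>" "finite \<tau>"
  shows "integrable P (\<lambda>\<omega>. rprod \<sigma> \<omega> * rprod \<tau> \<omega>)"
  by (rule integrable_mult_square_integrable_real [OF rprod_measurable rprod_measurable
        rprod_square_integrable [OF assms(1)] rprod_square_integrable [OF assms(2)]])

text \<open>Condition on \<open>past n\<close>, for which the remaining factors are measurable: a
  single factor \<open>noise M n\<close> is replaced by 0, a squared one by 1.\<close>

lemma rprod_orthogonal_insert:
  assumes "\<sigma> \<subseteq> {..<n}" "\<tau> \<subseteq> {..<n}"
  shows "(\<integral>\<omega>. rprod (insert n \<sigma>) \<omega> * rprod \<tau> \<omega> \<partial>P) = 0"
    and "(\<integral>\<omega>. rprod (insert n \<sigma>) \<omega> * rprod (insert n \<tau>) \<omega> \<partial>P) = (\<integral>\<omega>. rprod \<sigma> \<omega> * rprod \<tau> \<omega> \<partial>P)"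
proof -
  interpret sigma_finite_subalgebra P "past n" by (rule sigma_finite_subalgebra_past)
  have fin: "finite \<sigma>" "finite \<tau>" and n: "n \<notin> \<sigma>" "n \<notin> \<tau>"
    using assms by (auto intro: finite_subset)
  have meas: "(\<lambda>\<omega>. rprod \<sigma> \<omega> * rprod \<tau> \<omega>) \<in> borel_measurable (past n)"
    using assms by (intro borel_measurable_times rprod_measurable_past)
  have int: "integrable P (\<lambda>\<omega>. (rprod \<sigma> \<omega> * rprod \<tau> \<omega>) * noise M n \<omega>)"
    using rprod_mult_integrable [of "insert n \<sigma>" \<tau>] fin n by (simp add: rprod_insert mult_ac)
  have "(\<integral>\<omega>. rprod (insert n \<sigma>) \<omega> * rprod \<tau> \<omega> \<partial>P)
      = (\<integral>\<omega>. (rprod \<sigma> \<omega> * rprod \<tau> \<omega>) * noise M n \<omega> \<partial>P)"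
    using fin n by (simp add: rprod_insert mult_ac)
  also have "\<dots> = (\<integral>\<omega>. (rprod \<sigma> \<omega> * rprod \<tau> \<omega>) * real_cond_exp P (past n) (noise M n) \<omega> \<partial>P)"
    using real_cond_exp_intg(2) [OF int meas] by simp
  also have "\<dots> = (\<integral>\<omega>. 0 \<partial>P)"
    using cond_exp_noise [of n] by (intro integral_cong_AE) (auto elim: eventually_mono)
  finally show "(\<integral>\<omega>. rprod (insert n \<sigma>) \<omega> * rprod \<tau> \<omega> \<partial>P) = 0"
    by simp
  have int2: "integrable P (\<lambda>\<omega>. (rprod \<sigma> \<omega> * rprod \<tau> \<omega>) * (noise M n \<omega>)\<^sup>2)"
    using rprod_mult_integrable [of "insert n \<sigma>" "insert n \<tau>"] fin n
    by (simp add: rprod_insert mult_ac power2_eq_square)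
  have "(\<integral>\<omega>. rprod (insert n \<sigma>) \<omega> * rprod (insert n \<tau>) \<omega> \<partial>P)
      = (\<integral>\<omega>. (rprod \<sigma> \<omega> * rprod \<tau> \<omega>) * (noise M n \<omega>)\<^sup>2 \<partial>P)"
    using fin n by (simp add: rprod_insert mult_ac power2_eq_square)
  also have "\<dots> = (\<integral>\<omega>. (rprod \<sigma> \<omega> * rprod \<tau> \<omega>)
      * real_cond_exp P (past n) (\<lambda>\<omega>. (noise M n \<omega>)\<^sup>2) \<omega> \<partial>P)"
    using real_cond_exp_intg(2) [OF int2 meas] by simp
  also have "\<dots> = (\<integral>\<omega>. rprod \<sigma> \<omega> * rprod \<tau> \<omega> \<partial>P)"
    using cond_exp_noise_square [of n] by (intro integral_cong_AE) (auto elim: eventually_mono)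
  finally show "(\<integral>\<omega>. rprod (insert n \<sigma>) \<omega> * rprod (insert n \<tau>) \<omega> \<partial>P) = (\<integral>\<omega>. rprod \<sigma> \<omega> * rprod \<tau> \<omega> \<partial>P)" .
qed

text \<open>Induction on a common bound of the index sets. The top index N is removed from whichever
  sets contain it: in both, the integral is unchanged; in exactly one, it is 0 and the sets differ.
  The base case is the total mass 1.\<close>

lemma rprod_orthonormal_below:
  "\<sigma> \<subseteq> {..<N} \<Longrightarrow> \<tau> \<subseteq> {..<N} \<Longrightarrow> (\<integral>\<omega>. rprod \<sigma> \<omega> * rprod \<tau> \<omega> \<partial>P) = (if \<sigma> = \<tau> then 1 else 0)"
proof (induction N arbitrary: \<sigma> \<tau>)
  case 0
  then show ?case by (simp add: rprod_def prob_space)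
next
  case (Suc N)
  let ?s = "\<sigma> - {N}" and ?t = "\<tau> - {N}"
  have st: "?s \<subseteq> {..<N}" "?t \<subseteq> {..<N}"
    using Suc.prems by (auto simp: less_Suc_eq)
  note IH = Suc.IH [OF st]
  have ins: "N \<in> \<sigma> \<Longrightarrow> insert N ?s = \<sigma>" "N \<in> \<tau> \<Longrightarrow> insert N ?t = \<tau>"
    by (simp_all add: insert_absorb)
  have del: "N \<notin> \<sigma> \<Longrightarrow> ?s = \<sigma>" "N \<notin> \<tau> \<Longrightarrow> ?t = \<tau>"
    by simp_all
  consider "N \<in> \<sigma>" "N \<in> \<tau>" | "N \<in> \<sigma>" "N \<notin> \<tau>" | "N \<notin> \<sigma>" "N \<in> \<tau>" | "N \<notin> \<sigma>" "N \<notin> \<tau>"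
    by blast
  then show ?case
  proof cases
    case 1
    then have "\<sigma> = \<tau> \<longleftrightarrow> ?s = ?t" by blast
    with IH rprod_orthogonal_insert(2) [OF st] ins 1 show ?thesis by simp
  next
    case 2
    with rprod_orthogonal_insert(1) [OF st] ins del show ?thesis by auto
  next
    case 3
    with rprod_orthogonal_insert(1) [OF st(2) st(1)] ins del show ?thesis
      by (auto simp: mult.commute)
  next
    case 4
    with IH del show ?thesis by simp
  qed
qed

lemma rprod_orthonormal:
  assumes "finite \<sigma>" "finite \<tau>"
  shows "(\<integral>\<omega>. rprod \<sigma> \<omega> * rprod \<tau> \<omega> \<partial>P) = (if \<sigma> = \<tau> then 1 else 0)"
proof -
  obtain N where "\<sigma> \<union> \<tau> \<subseteq> {..<N}"
    using assms finite_nat_iff_bounded [of "\<sigma> \<union> \<tau>"] by blast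
  then show ?thesis by (intro rprod_orthonormal_below [of _ N]) auto
qed

end


section \<open>Infinite sums and weights\<close>

text \<open>Minkowski's inequality on finite subsets bounds all partial sums by one constant, which
  yields summability and the estimate together. The pointwise inequality for h, rather than h = f +
  g, fits weighted moduli of coefficients, which are only subadditive.\<close>

lemma sqrt_infsum_triangle:
  fixes f g h :: "'i \<Rightarrow> real"
  assumes f: "(\<lambda>i. (f i)\<^sup>2) summable_on A" and g: "(\<lambda>i. (g i)\<^sup>2) summable_on A"
    and h: "\<And>i. i \<in> A \<Longrightarrow> \<bar>h i\<bar> \<le> \<bar>f i\<bar> + \<bar>g i\<bar>"
  shows "(\<lambda>i. (h i)\<^sup>2) summable_on A"
    and "sqrt (\<Sum>\<^sub>\<infinity>i\<in>A. (h i)\<^sup>2) \<le> sqrt (\<Sum>\<^sub>\<infinity>i\<in>A. (f i)\<^sup>2) + sqrt (\<Sum>\<^sub>\<infinity>i\<in>A. (g i)\<^sup>2)"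
proof -
  let ?R = "sqrt (\<Sum>\<^sub>\<infinity>i\<in>A. (f i)\<^sup>2) + sqrt (\<Sum>\<^sub>\<infinity>i\<in>A. (g i)\<^sup>2)"
  have R: "?R \<ge> 0" by (simp add: infsum_nonneg)
  have bound: "(\<Sum>i\<in>F. (h i)\<^sup>2) \<le> ?R\<^sup>2" if "finite F" "F \<subseteq> A" for F
  proof -
    have part: "L2_set u F \<le> sqrt (\<Sum>\<^sub>\<infinity>i\<in>A. (u i)\<^sup>2)" if "(\<lambda>i. (u i)\<^sup>2) summable_on A" for u
      unfolding L2_set_def using that \<open>finite F\<close> \<open>F \<subseteq> A\<close>
      by (intro real_sqrt_le_mono finite_sum_le_infsum) auto
    have "L2_set h F = L2_set (\<lambda>i. \<bar>h i\<bar>) F"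
      by (simp add: L2_set_def)
    also have "\<dots> \<le> L2_set (\<lambda>i. \<bar>f i\<bar> + \<bar>g i\<bar>) F"
      using that h by (intro L2_set_mono) auto
    also have "\<dots> \<le> L2_set (\<lambda>i. \<bar>f i\<bar>) F + L2_set (\<lambda>i. \<bar>g i\<bar>) F"
      by (rule L2_set_triangle_ineq)
    also have "\<dots> \<le> ?R"
      using part [OF f] part [OF g] by (intro add_mono) (simp_all add: L2_set_def)
    finally show ?thesis
      using R by (simp add: L2_set_def real_sqrt_le_iff sqrt_le_D)
  qed
  show summ: "(\<lambda>i. (h i)\<^sup>2) summable_on A"
    using bound by (intro nonneg_bdd_above_summable_on bdd_aboveI2 [where M = "?R\<^sup>2"]) auto
  show "sqrt (\<Sum>\<^sub>\<infinity>i\<in>A. (h i)\<^sup>2) \<le> ?R"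
    using infsum_le_finite_sums [OF summ bound] R by (simp add: real_le_lsqrt infsum_nonneg)
qed

text \<open>Dominated convergence for unordered sums: a finite set carries all but \<epsilon>/3 of
  the sum of g, and on it the sum of the \<open>b n\<close> tends to 0. Domination is asked only
  eventually, so that the index 0 may be ignored later.\<close>

lemma tendsto_infsum_dominated:
  fixes b :: "nat \<Rightarrow> 'i \<Rightarrow> real"
  assumes g: "g summable_on A" and lim: "\<And>i. i \<in> A \<Longrightarrow> (\<lambda>n. b n i) \<longlonglongrightarrow> 0"
    and nonneg: "\<And>n i. i \<in> A \<Longrightarrow> 0 \<le> b n i"
    and bound: "\<forall>\<^sub>F n in sequentially. \<forall>i\<in>A. b n i \<le> g i"
  shows "(\<lambda>n. infsum (b n) A) \<longlonglongrightarrow> 0"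
proof (rule tendstoI)
  fix \<epsilon> :: real assume \<epsilon>: "\<epsilon> > 0"
  obtain F where F: "finite F" "F \<subseteq> A" and "dist (sum g F) (infsum g A) \<le> \<epsilon> / 3"
    using has_sum_finite_approximation [OF has_sum_infsum [OF g], of "\<epsilon> / 3"] \<epsilon> by auto
  then have tail: "infsum g A - sum g F \<le> \<epsilon> / 3"
    unfolding dist_real_def by linarith
  have "(\<lambda>n. \<Sum>i\<in>F. b n i) \<longlonglongrightarrow> (\<Sum>i\<in>F. 0)"
    using F lim by (intro tendsto_sum) auto
  then have "\<forall>\<^sub>F n in sequentially. (\<Sum>i\<in>F. b n i) < \<epsilon> / 3"
    using \<epsilon> by (intro order_tendstoD(2)) auto
  then show "\<forall>\<^sub>F n in sequentially. dist (infsum (b n) A) 0 < \<epsilon>"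
    using bound
  proof eventually_elim
    case (elim n)
    have b: "b n summable_on A"
      using elim nonneg by (intro summable_on_comparison_test [OF g]) auto
    have "infsum (b n) A - sum (b n) F = infsum (b n) (A - F)"
      using b F by (subst infsum_Diff) auto
    also have "\<dots> \<le> infsum g (A - F)"
      using elim b g F by (intro infsum_mono summable_on_Diff) auto
    also have "\<dots> = infsum g A - sum g F"
      using g F by (subst infsum_Diff) auto
    finally have "infsum (b n) A < \<epsilon>"
      using elim tail \<epsilon> by linarith
    moreover have "infsum (b n) A \<ge> 0"
      using nonneg by (intro infsum_nonneg) auto
    ultimately show ?case by (simp add: dist_real_def)
  qed
qed

section \<open>Weights and the summability of their inverse squares\<close>

lemma weight_ge_1: "weight \<sigma> \<ge> 1"
  unfolding weight_def by (intro prod_ge_1) auto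

lemma weight_pos [simp]: "weight \<sigma> > 0"
  using weight_ge_1 [of \<sigma>] by linarith

lemma weight_nonzero [simp]: "weight \<sigma> \<noteq> 0"
  using weight_pos [of \<sigma>] by linarith

text \<open>The sum over all finite sets is the infinite product of the factors
  \<open>1 + (k + 1)\<^sup>-\<^sup>2\<close>.\<close>

lemma weight_summable: "(\<lambda>\<sigma>. weight \<sigma> powr - 2) summable_on \<Gamma>"
\<comment> \<open>The bound comes from 1 + x \<le> exp x and the value pi^2/6 of the sum of the
  inverse squares.\<close>
proof (intro nonneg_bdd_above_summable_on bdd_aboveI2 [where M = "exp (pi\<^sup>2 / 6)"])
  fix F assume "F \<in> {F. F \<subseteq> \<Gamma> \<and> finite F}"
  then have "finite F" "finite (\<Union>F)" by auto
  then obtain N where N: "\<Union>F \<subseteq> {..<N}"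
    using finite_nat_iff_bounded by blast
  let ?x = "\<lambda>k::nat. 1 / (real k + 1)\<^sup>2"
  \<comment> \<open>The product of ones over the complement makes this one term, indexed by a subset
    of {..<N}, of the expansion of the product of all \<open>?x k + 1\<close>.\<close>
  have eq: "weight \<sigma> powr - 2 = (\<Prod>k\<in>\<sigma>. ?x k) * (\<Prod>k\<in>{..<N} - \<sigma>. 1)" for \<sigma>
    using weight_pos [of \<sigma>]
    by (simp add: powr_minus weight_def prod_power_distrib prod_dividef inverse_eq_divide
        del: weight_pos)
  have "(\<Sum>\<sigma>\<in>F. weight \<sigma> powr - 2) \<le> (\<Sum>\<sigma>\<in>Pow {..<N}. weight \<sigma> powr - 2)"
    using N by (intro sum_mono2) auto
  also have "\<dots> = (\<Prod>k<N. ?x k + 1)"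
    unfolding eq by (rule prod_add [symmetric]) simp
  also have "\<dots> \<le> (\<Prod>k<N. exp (?x k))"
    by (intro prod_mono) (auto simp: add.commute [of _ 1] exp_ge_add_one_self)
  also have "\<dots> = exp (\<Sum>k<N. ?x k)"
    by (simp add: exp_sum)
  also have "(\<Sum>k<N. ?x k) \<le> (\<Sum>k. ?x k)"
    using inverse_squares_sums
    by (intro sum_le_suminf) (auto simp: sums_iff add.commute)
  also have "(\<Sum>k. ?x k) = pi\<^sup>2 / 6"
    using inverse_squares_sums by (simp add: sums_iff add.commute)
  finally show "(\<Sum>\<sigma>\<in>F. weight \<sigma> powr - 2) \<le> exp (pi\<^sup>2 / 6)" by simp
qed simp

section \<open>The seminorms and the topology of test functionals\<close>

context normal_martingale_space
begin

section \<open>Square integrable functionals and their coefficients\<close>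

abbreviation coef :: "nat set \<Rightarrow> ('a \<Rightarrow> complex) \<Rightarrow> complex"
  where "coef \<sigma> \<xi> \<equiv> L2_inner P (noise_prod M \<sigma>) \<xi>"

abbreviation "testing \<equiv> testing_functionals P M"

abbreviation "pnorm \<equiv> Sp_norm P M"

lemma noise_prod_eq_rprod: "noise_prod M \<sigma> \<omega> = complex_of_real (rprod \<sigma> \<omega>)"
  by (simp add: noise_prod_def rprod_def)

lemma noise_prod_L2:
  assumes "finite \<sigma>"
  shows "noise_prod M \<sigma> \<in> L2 P M"
proof -
  have "M i \<in> borel_measurable (natural_algebra P M UNIV)" for i
    by (simp add: measurable_natural_algebra)
  then have "noise M i \<in> borel_measurable (natural_algebra P M UNIV)" for i
    by (cases "i = 0") (simp_all add: noise_def [abs_def])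
  then have "rprod \<sigma> \<in> borel_measurable (natural_algebra P M UNIV)"
    unfolding rprod_def [abs_def] by (intro borel_measurable_prod)
  from measurable_compose [OF this borel_measurable_of_real]
  have "noise_prod M \<sigma> \<in> borel_measurable (natural_algebra P M UNIV)"
    by (simp add: noise_prod_eq_rprod [abs_def])
  with assms show ?thesis
    by (simp add: L2_def noise_prod_eq_rprod rprod_square_integrable)
qed

lemma L2_add:
  assumes "\<xi> \<in> L2 P M" "\<eta> \<in> L2 P M"
  shows "(\<lambda>\<omega>. \<xi> \<omega> + \<eta> \<omega>) \<in> L2 P M"
proof -
  note [measurable] = L2_measurable [OF normal assms(1)] L2_measurable [OF normal assms(2)]
  have "integrable P (\<lambda>\<omega>. (cmod (\<xi> \<omega> + \<eta> \<omega>))\<^sup>2)"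
  proof (rule Bochner_Integration.integrable_bound)
    show "integrable P (\<lambda>\<omega>. 2 * (cmod (\<xi> \<omega>))\<^sup>2 + 2 * (cmod (\<eta> \<omega>))\<^sup>2)"
      using assms by (simp add: L2_def)
    have "(cmod (x + y))\<^sup>2 \<le> 2 * (cmod x)\<^sup>2 + 2 * (cmod y)\<^sup>2" for x y
    proof -
      have "(cmod (x + y))\<^sup>2 \<le> (cmod x + cmod y)\<^sup>2"
        by (intro power_mono norm_triangle_ineq) simp
      also have "\<dots> \<le> 2 * (cmod x)\<^sup>2 + 2 * (cmod y)\<^sup>2"
        using sum_squares_bound [of "cmod x" "cmod y"] by (simp add: power2_sum)
      finally show ?thesis .
    qed
    then show "AE \<omega> in P. norm ((cmod (\<xi> \<omega> + \<eta> \<omega>))\<^sup>2)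
        \<le> norm (2 * (cmod (\<xi> \<omega>))\<^sup>2 + 2 * (cmod (\<eta> \<omega>))\<^sup>2)"
      by simp
  qed simp
  moreover have "(\<lambda>\<omega>. \<xi> \<omega> + \<eta> \<omega>) \<in> borel_measurable (natural_algebra P M UNIV)"
    using assms by (intro borel_measurable_add) (auto simp only: L2_def)
  ultimately show ?thesis unfolding L2_def by blast
qed

lemma L2_scale:
  assumes "\<xi> \<in> L2 P M"
  shows "(\<lambda>\<omega>. c * \<xi> \<omega>) \<in> L2 P M"
proof -
  have "\<xi> \<in> borel_measurable (natural_algebra P M UNIV)" "integrable P (\<lambda>\<omega>. (cmod (\<xi> \<omega>))\<^sup>2)"
    using assms by (simp_all add: L2_def)
  then have "(\<lambda>\<omega>. c * \<xi> \<omega>) \<in> borel_measurable (natural_algebra P M UNIV)"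
      "integrable P (\<lambda>\<omega>. (cmod (c * \<xi> \<omega>))\<^sup>2)"
    by (intro borel_measurable_times borel_measurable_const, simp_all add: norm_mult power_mult_distrib)
  then show ?thesis unfolding L2_def by blast
qed

lemma integrable_noise_prod_mult:
  assumes "finite \<sigma>" "\<xi> \<in> L2 P M"
  shows "integrable P (\<lambda>\<omega>. cnj (noise_prod M \<sigma> \<omega>) * \<xi> \<omega>)"
proof -
  have "cnj (noise_prod M \<sigma> \<omega>) = noise_prod M \<sigma> \<omega>" for \<omega>
    by (simp add: noise_prod_def)
  moreover have "integrable P (\<lambda>\<omega>. noise_prod M \<sigma> \<omega> * \<xi> \<omega>)"
    using assms noise_prod_L2 [OF assms(1)]
    by (intro integrable_mult_square_integrable L2_measurable [OF normal]) (auto simp only: L2_def)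
  ultimately show ?thesis by simp
qed

lemma coef_add:
  assumes "finite \<sigma>" "\<xi> \<in> L2 P M" "\<eta> \<in> L2 P M"
  shows "coef \<sigma> (\<lambda>\<omega>. \<xi> \<omega> + \<eta> \<omega>) = coef \<sigma> \<xi> + coef \<sigma> \<eta>"
  using assms by (simp add: L2_inner_def distrib_left integrable_noise_prod_mult)

lemma coef_scale: "coef \<sigma> (\<lambda>\<omega>. c * \<xi> \<omega>) = c * coef \<sigma> \<xi>"
  by (simp add: L2_inner_def mult.left_commute)

lemma coef_noise_prod:
  assumes "finite \<sigma>" "finite \<tau>"
  shows "coef \<sigma> (noise_prod M \<tau>) = (if \<sigma> = \<tau> then 1 else 0)"
proof -
  have "coef \<sigma> (noise_prod M \<tau>) = (\<integral>\<omega>. complex_of_real (rprod \<sigma> \<omega> * rprod \<tau> \<omega>) \<partial>P)"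
    by (simp add: L2_inner_def noise_prod_eq_rprod)
  also have "\<dots> = complex_of_real (\<integral>\<omega>. rprod \<sigma> \<omega> * rprod \<tau> \<omega> \<partial>P)"
    by (rule integral_complex_of_real)
  finally show ?thesis
    using rprod_orthonormal [OF assms] by simp
qed

text \<open>The square root of a summand of \<open>Sp_norm\<close>, so that \<open>pnorm p\<close>
  becomes the l2 norm of this family and Minkowski's inequality applies.\<close>

definition wcoef :: "real \<Rightarrow> ('a \<Rightarrow> complex) \<Rightarrow> nat set \<Rightarrow> real"
  where "wcoef p \<xi> \<sigma> = weight \<sigma> powr p * cmod (coef \<sigma> \<xi>)"

lemma wcoef_square: "(wcoef p \<xi> \<sigma>)\<^sup>2 = weight \<sigma> powr (2 * p) * (cmod (coef \<sigma> \<xi>))\<^sup>2"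
proof -
  have "(weight \<sigma> powr p)\<^sup>2 = weight \<sigma> powr (2 * p)"
    by (simp add: power2_eq_square flip: powr_add)
  then show ?thesis by (simp add: wcoef_def power_mult_distrib)
qed

lemma pnorm_eq: "pnorm p \<xi> = sqrt (\<Sum>\<^sub>\<infinity>\<sigma>\<in>\<Gamma>. (wcoef p \<xi> \<sigma>)\<^sup>2)"
  by (simp add: Sp_norm_def wcoef_square)

lemma wcoef_nonneg [simp]: "wcoef p \<xi> \<sigma> \<ge> 0"
  by (simp add: wcoef_def)

lemma wcoef_mono: "p \<le> q \<Longrightarrow> wcoef p \<xi> \<sigma> \<le> wcoef q \<xi> \<sigma>"
  unfolding wcoef_def by (intro mult_right_mono powr_mono weight_ge_1) auto

lemma testing_L2: "\<xi> \<in> testing \<Longrightarrow> \<xi> \<in> L2 P M"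
  by (auto simp: testing_functionals_def Sp_def)

text \<open>\<open>testing_functionals\<close> intersects over natural exponents only; real ones
  follow by comparison with a larger natural exponent, as all weights are at least 1.\<close>

lemma testing_summable:
  assumes "\<xi> \<in> testing"
  shows "(\<lambda>\<sigma>. (wcoef p \<xi> \<sigma>)\<^sup>2) summable_on \<Gamma>"
proof -
  obtain n where n: "p \<le> real n" using real_arch_simple by blast
  have "(\<lambda>\<sigma>. (wcoef (real n) \<xi> \<sigma>)\<^sup>2) summable_on \<Gamma>"
    using assms by (auto simp: testing_functionals_def Sp_def wcoef_square)
  then show ?thesis
  proof (rule summable_on_comparison_test)
    show "(wcoef p \<xi> \<sigma>)\<^sup>2 \<le> (wcoef (real n) \<xi> \<sigma>)\<^sup>2" for \<sigma>
      using n by (intro power_mono wcoef_mono) simp_all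
  qed simp
qed

lemma testingI:
  assumes "\<xi> \<in> L2 P M" "\<And>p. (\<lambda>\<sigma>. (wcoef p \<xi> \<sigma>)\<^sup>2) summable_on \<Gamma>"
  shows "\<xi> \<in> testing"
  unfolding testing_functionals_def Sp_def wcoef_square [symmetric] using assms by blast

lemma wcoef_add:
  assumes "\<xi> \<in> testing" "\<eta> \<in> testing" "finite \<sigma>"
  shows "wcoef p (\<lambda>\<omega>. \<xi> \<omega> + \<eta> \<omega>) \<sigma> \<le> wcoef p \<xi> \<sigma> + wcoef p \<eta> \<sigma>"
  unfolding wcoef_def distrib_left [symmetric]
  using assms by (intro mult_left_mono) (simp_all add: coef_add testing_L2 norm_triangle_ineq)

lemma testing_add:
  assumes "\<xi> \<in> testing" "\<eta> \<in> testing"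
  shows "(\<lambda>\<omega>. \<xi> \<omega> + \<eta> \<omega>) \<in> testing"
proof (rule testingI)
  show "(\<lambda>\<omega>. \<xi> \<omega> + \<eta> \<omega>) \<in> L2 P M"
    using assms by (intro L2_add testing_L2)
  fix p
  show "(\<lambda>\<sigma>. (wcoef p (\<lambda>\<omega>. \<xi> \<omega> + \<eta> \<omega>) \<sigma>)\<^sup>2) summable_on \<Gamma>"
    using testing_summable [OF assms(1), of p] testing_summable [OF assms(2), of p]
    by (rule sqrt_infsum_triangle(1)) (simp add: wcoef_add assms)
qed

lemma pnorm_triangle:
  assumes "\<xi> \<in> testing" "\<eta> \<in> testing"
  shows "pnorm p (\<lambda>\<omega>. \<xi> \<omega> + \<eta> \<omega>) \<le> pnorm p \<xi> + pnorm p \<eta>"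
  unfolding pnorm_eq
  using testing_summable [OF assms(1), of p] testing_summable [OF assms(2), of p]
  by (rule sqrt_infsum_triangle(2)) (simp add: wcoef_add assms)

lemma wcoef_scale: "wcoef p (\<lambda>\<omega>. c * \<xi> \<omega>) \<sigma> = cmod c * wcoef p \<xi> \<sigma>"
  by (simp add: wcoef_def coef_scale norm_mult)

lemma testing_scale: "\<xi> \<in> testing \<Longrightarrow> (\<lambda>\<omega>. c * \<xi> \<omega>) \<in> testing"
  by (intro testingI)
    (auto simp: testing_L2 L2_scale wcoef_scale power_mult_distrib
      intro!: summable_on_cmult_right testing_summable)

lemma pnorm_scale: "pnorm p (\<lambda>\<omega>. c * \<xi> \<omega>) = cmod c * pnorm p \<xi>"
  by (simp add: pnorm_eq wcoef_scale power_mult_distrib infsum_cmult_right' real_sqrt_mult)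

lemma testing_diff: "\<xi> \<in> testing \<Longrightarrow> \<eta> \<in> testing \<Longrightarrow> (\<lambda>\<omega>. \<xi> \<omega> - \<eta> \<omega>) \<in> testing"
  using testing_add [OF _ testing_scale, of \<xi> \<eta> "- 1"] by simp

lemma testing_zero: "(\<lambda>\<omega>. 0) \<in> testing"
  by (intro testingI) (simp_all add: L2_def wcoef_def L2_inner_def)

lemma pnorm_zero [simp]: "pnorm p (\<lambda>\<omega>. 0) = 0"
  by (simp add: pnorm_eq wcoef_def L2_inner_def)

lemma pnorm_nonneg [simp]: "pnorm p \<xi> \<ge> 0"
  by (simp add: pnorm_eq infsum_nonneg)

lemma pnorm_mono: "\<xi> \<in> testing \<Longrightarrow> p \<le> q \<Longrightarrow> pnorm p \<xi> \<le> pnorm q \<xi>"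
  unfolding pnorm_eq
  by (intro real_sqrt_le_mono infsum_mono testing_summable power_mono wcoef_mono) auto

text \<open>A single term is at most the whole sum; thus a bound on one seminorm becomes a decay
  rate for the coefficients.\<close>

lemma wcoef_le_pnorm:
  assumes "\<xi> \<in> testing" "finite \<sigma>"
  shows "wcoef p \<xi> \<sigma> \<le> pnorm p \<xi>"
proof -
  have "(\<Sum>\<tau>\<in>{\<sigma>}. (wcoef p \<xi> \<tau>)\<^sup>2) \<le> (\<Sum>\<^sub>\<infinity>\<tau>\<in>\<Gamma>. (wcoef p \<xi> \<tau>)\<^sup>2)"
    using assms by (intro finite_sum_le_infsum testing_summable) auto
  then show ?thesis
    unfolding pnorm_eq by (simp add: real_le_rsqrt)
qed

section \<open>Noise products, their finite combinations and truncated expansions\<close>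

lemma wcoef_noise_prod:
  "finite \<sigma> \<Longrightarrow> finite \<tau> \<Longrightarrow> wcoef p (noise_prod M \<tau>) \<sigma> = (if \<sigma> = \<tau> then weight \<sigma> powr p else 0)"
  by (simp add: wcoef_def coef_noise_prod)

lemma testing_noise_prod:
  assumes "finite \<sigma>"
  shows "noise_prod M \<sigma> \<in> testing"
proof (intro testingI noise_prod_L2 assms)
  fix p
  have "(\<lambda>\<tau>. (wcoef p (noise_prod M \<sigma>) \<tau>)\<^sup>2) summable_on {\<sigma>}"
    by simp
  then show "(\<lambda>\<tau>. (wcoef p (noise_prod M \<sigma>) \<tau>)\<^sup>2) summable_on \<Gamma>"
    by (rule summable_on_cong_neutral [THEN iffD1, rotated -1])
      (use assms in \<open>auto simp: wcoef_noise_prod\<close>)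
qed

lemma pnorm_noise_prod:
  assumes "finite \<sigma>"
  shows "pnorm p (noise_prod M \<sigma>) = weight \<sigma> powr p"
proof -
  have "(\<Sum>\<^sub>\<infinity>\<tau>\<in>\<Gamma>. (wcoef p (noise_prod M \<sigma>) \<tau>)\<^sup>2) = (\<Sum>\<^sub>\<infinity>\<tau>\<in>{\<sigma>}. (wcoef p (noise_prod M \<sigma>) \<tau>)\<^sup>2)"
    by (rule infsum_cong_neutral) (use assms in \<open>auto simp: wcoef_noise_prod\<close>)
  with assms show ?thesis by (simp add: pnorm_eq wcoef_noise_prod)
qed

lemma testing_sum:
  assumes "finite A" "A \<subseteq> \<Gamma>"
  shows "(\<lambda>\<omega>. \<Sum>\<sigma>\<in>A. c \<sigma> * noise_prod M \<sigma> \<omega>) \<in> testing"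
  using assms
proof (induction A)
  case empty
  show ?case by (simp add: testing_zero)
next
  case (insert \<sigma> A)
  then have "finite \<sigma>" "(\<lambda>\<omega>. \<Sum>\<sigma>\<in>A. c \<sigma> * noise_prod M \<sigma> \<omega>) \<in> testing"
    by blast+
  from testing_add [OF testing_scale [OF testing_noise_prod [OF this(1)], of "c \<sigma>"] this(2)]
  show ?case
    by (simp only: sum.insert insert.hyps not_False_eq_True)
qed

lemma coef_sum:
  assumes "finite A" "A \<subseteq> \<Gamma>" "finite \<sigma>"
  shows "coef \<sigma> (\<lambda>\<omega>. \<Sum>\<tau>\<in>A. c \<tau> * noise_prod M \<tau> \<omega>) = (if \<sigma> \<in> A then c \<sigma> else 0)"
  using assms
proof (induction A)
  case empty
  then show ?case by (simp add: L2_inner_def)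
next
  case (insert \<tau> A)
  have "(\<lambda>\<omega>. c \<tau> * noise_prod M \<tau> \<omega>) \<in> L2 P M" "(\<lambda>\<omega>. \<Sum>\<tau>\<in>A. c \<tau> * noise_prod M \<tau> \<omega>) \<in> L2 P M"
    using insert.hyps insert.prems
    by (auto simp only: insert_subset mem_Collect_eq
        intro!: testing_L2 [OF testing_scale [OF testing_noise_prod]] testing_L2 [OF testing_sum])
  from coef_add [OF \<open>finite \<sigma>\<close> this]
  have "coef \<sigma> (\<lambda>\<omega>. \<Sum>\<tau>\<in>insert \<tau> A. c \<tau> * noise_prod M \<tau> \<omega>)
      = c \<tau> * coef \<sigma> (noise_prod M \<tau>) + coef \<sigma> (\<lambda>\<omega>. \<Sum>\<tau>\<in>A. c \<tau> * noise_prod M \<tau> \<omega>)"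
    using insert.hyps by (simp only: coef_scale sum.insert not_False_eq_True)
  also have "coef \<sigma> (\<lambda>\<omega>. \<Sum>\<tau>\<in>A. c \<tau> * noise_prod M \<tau> \<omega>) = (if \<sigma> \<in> A then c \<sigma> else 0)"
    using insert.IH insert.prems by blast
  also have "coef \<sigma> (noise_prod M \<tau>) = (if \<sigma> = \<tau> then 1 else 0)"
    using insert.prems by (intro coef_noise_prod) auto
  finally show ?case
    using insert.hyps by auto
qed

text \<open>By orthonormality, subtracting the partial sum over A deletes exactly the coefficients
  in A, so the squared seminorm of the remainder is the tail of a convergent sum.\<close>

lemma pnorm_truncation_tendsto:
  assumes \<xi>: "\<xi> \<in> testing"
  shows "((\<lambda>A. pnorm p (\<lambda>\<omega>. \<xi> \<omega> - (\<Sum>\<sigma>\<in>A. coef \<sigma> \<xi> * noise_prod M \<sigma> \<omega>))) \<longlongrightarrow> 0)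
    (finite_subsets_at_top \<Gamma>)"
proof -
  let ?f = "\<lambda>\<sigma>. (wcoef p \<xi> \<sigma>)\<^sup>2"
  have eq: "pnorm p (\<lambda>\<omega>. \<xi> \<omega> - (\<Sum>\<sigma>\<in>A. coef \<sigma> \<xi> * noise_prod M \<sigma> \<omega>)) = sqrt (infsum ?f \<Gamma> - sum ?f A)"
    if A: "finite A" "A \<subseteq> \<Gamma>" for A
  proof -
    let ?\<eta> = "\<lambda>\<omega>. \<Sum>\<sigma>\<in>A. coef \<sigma> \<xi> * noise_prod M \<sigma> \<omega>"
    have "coef \<sigma> (\<lambda>\<omega>. \<xi> \<omega> - ?\<eta> \<omega>) = (if \<sigma> \<in> A then 0 else coef \<sigma> \<xi>)" if "\<sigma> \<in> \<Gamma>" for \<sigma>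
      \<comment> \<open>The difference is treated as a sum with the multiple by -1.\<close>
      using coef_add [OF _ testing_L2 [OF \<xi>] L2_scale [OF testing_L2 [OF testing_sum [OF A]]],
          of \<sigma> "- 1"] that A
      by (simp add: coef_scale [of _ "- 1", simplified] coef_sum)
    then have w: "wcoef p (\<lambda>\<omega>. \<xi> \<omega> - ?\<eta> \<omega>) \<sigma> = (if \<sigma> \<in> A then 0 else wcoef p \<xi> \<sigma>)" if "\<sigma> \<in> \<Gamma>" for \<sigma>
      using that by (simp add: wcoef_def)
    have "(\<Sum>\<^sub>\<infinity>\<sigma>\<in>\<Gamma>. (wcoef p (\<lambda>\<omega>. \<xi> \<omega> - ?\<eta> \<omega>) \<sigma>)\<^sup>2) = infsum ?f (\<Gamma> - A)"
      by (rule infsum_cong_neutral) (use w in auto)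
    also have "\<dots> = infsum ?f \<Gamma> - sum ?f A"
      using A by (subst infsum_Diff) (auto simp: testing_summable \<xi>)
    finally show ?thesis by (simp add: pnorm_eq)
  qed
  have "((\<lambda>A. sqrt (infsum ?f \<Gamma> - sum ?f A)) \<longlongrightarrow> sqrt (infsum ?f \<Gamma> - infsum ?f \<Gamma>)) (finite_subsets_at_top \<Gamma>)"
    by (intro tendsto_intros infsum_tendsto testing_summable \<xi>)
  then have "((\<lambda>A. sqrt (infsum ?f \<Gamma> - sum ?f A)) \<longlongrightarrow> 0) (finite_subsets_at_top \<Gamma>)"
    by simp
  then show ?thesis
    by (rule Lim_transform_eventually) (simp add: eq eventually_finite_subsets_at_top_weakI)
qed

section \<open>Neighbourhoods of zero and bounded sets\<close>

lemma openin_testing_ball: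
  assumes "p \<ge> 0" "\<epsilon> > 0"
  shows "openin (testing_topology P M) {\<eta> \<in> testing. pnorm p \<eta> < \<epsilon>}"
  unfolding testing_topology_def openin_topology_generated_by_iff
proof (rule generate_topology_on.Basis, rule CollectI, intro exI conjI)
  show "{\<eta> \<in> testing. pnorm p \<eta> < \<epsilon>} = {\<eta> \<in> testing. pnorm p (\<lambda>\<omega>. \<eta> \<omega> - 0) < \<epsilon>}"
    by simp
qed (fact testing_zero assms)+

text \<open>The generators are balls with arbitrary centres, hence the induction over the generated
  topology. Finite intersections reduce to one ball because the seminorms increase with the
  exponent.\<close>

lemma testing_nbhd_zero:
  assumes "openin (testing_topology P M) U" "(\<lambda>\<omega>. 0) \<in> U"
  shows "\<exists>p\<ge>0. \<exists>\<epsilon>>0. {\<eta> \<in> testing. pnorm p \<eta> < \<epsilon>} \<subseteq> U"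
proof -
  let ?T = "{{\<eta> \<in> testing. pnorm p (\<lambda>\<omega>. \<eta> \<omega> - \<xi> \<omega>) < \<epsilon>} | \<xi> p \<epsilon>. \<xi> \<in> testing \<and> p \<ge> 0 \<and> \<epsilon> > 0}"
  have "generate_topology_on ?T U"
    using assms(1) by (simp add: testing_topology_def openin_topology_generated_by_iff)
  then show ?thesis
    using assms(2)
  proof induction
    case (Int a b)
    then obtain p q \<epsilon> \<delta> where *: "p \<ge> 0" "q \<ge> 0" "\<epsilon> > 0" "\<delta> > 0"
      "{\<eta> \<in> testing. pnorm p \<eta> < \<epsilon>} \<subseteq> a" "{\<eta> \<in> testing. pnorm q \<eta> < \<delta>} \<subseteq> b"
      by blast
    then have "{\<eta> \<in> testing. pnorm (max p q) \<eta> < min \<epsilon> \<delta>} \<subseteq> a \<inter> b"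
      using pnorm_mono [of _ p "max p q"] pnorm_mono [of _ q "max p q"] by fastforce
    moreover have "max p q \<ge> 0" "min \<epsilon> \<delta> > 0" using * by auto
    ultimately show ?case by blast
  next
    case (UN K)
    then obtain k where k: "k \<in> K" "(\<lambda>\<omega>. 0) \<in> k" by blast
    from UN.IH [OF k] k(1) show ?case by blast
  next
    case (Basis s)
    then obtain \<xi> p \<epsilon> where s: "s = {\<eta> \<in> testing. pnorm p (\<lambda>\<omega>. \<eta> \<omega> - \<xi> \<omega>) < \<epsilon>}"
      and \<xi>: "\<xi> \<in> testing" "p \<ge> 0" by blast
    \<comment> \<open>This is the distance from 0 to the centre \<xi>; the triangle inequality
      leaves the radius \<epsilon> - \<open>?r\<close> for a ball around 0.\<close>
    let ?r = "pnorm p (\<lambda>\<omega>. - \<xi> \<omega>)"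
    have neg: "(\<lambda>\<omega>. - \<xi> \<omega>) \<in> testing"
      using testing_scale [OF \<xi>(1), of "- 1"] by simp
    have "?r < \<epsilon>" using Basis s by simp
    moreover have "{\<eta> \<in> testing. pnorm p \<eta> < \<epsilon> - ?r} \<subseteq> s"
      using pnorm_triangle [OF _ neg, of _ p] by (force simp: s)
    ultimately show ?case using \<xi>(2) by (meson diff_gt_0_iff_gt)
  qed simp
qed

text \<open>Absorption by the unit ball of \<open>pnorm p\<close> bounds that seminorm on B.
  Conversely every neighbourhood of zero contains a ball of a single seminorm, and a large enough
  dilation of it covers B.\<close>

lemma testing_bounded_iff:
  "testing_bounded P M B \<longleftrightarrow> B \<subseteq> testing \<and> (\<forall>p\<ge>0. \<exists>K. \<forall>\<xi>\<in>B. pnorm p \<xi> \<le> K)"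
proof safe
  fix \<xi> assume "testing_bounded P M B" "\<xi> \<in> B"
  then show "\<xi> \<in> testing" by (auto simp: testing_bounded_def)
next
  fix p :: real assume B: "testing_bounded P M B" and p: "p \<ge> 0"
  let ?U = "{\<eta> \<in> testing. pnorm p \<eta> < 1}"
  have "openin (testing_topology P M) ?U" "(\<lambda>\<omega>. 0) \<in> ?U"
    using p openin_testing_ball [of p 1] testing_zero by auto
  then obtain r where r: "r > 0" "B \<subseteq> (\<lambda>\<xi> \<omega>. complex_of_real r * \<xi> \<omega>) ` ?U"
    using B unfolding testing_bounded_def by blast
  then have "pnorm p \<xi> \<le> r" if "\<xi> \<in> B" for \<xi>
    using that by (auto simp: pnorm_scale dest!: subsetD)
  then show "\<exists>K. \<forall>\<xi>\<in>B. pnorm p \<xi> \<le> K" by blast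
next
  assume B: "B \<subseteq> testing" and K: "\<forall>p\<ge>0. \<exists>K. \<forall>\<xi>\<in>B. pnorm p \<xi> \<le> K"
  show "testing_bounded P M B"
    unfolding testing_bounded_def
  proof (intro conjI allI impI B)
    fix U assume "openin (testing_topology P M) U \<and> (\<lambda>\<omega>. 0) \<in> U"
    then obtain p \<epsilon> where p: "p \<ge> 0" "\<epsilon> > 0" and U: "{\<eta> \<in> testing. pnorm p \<eta> < \<epsilon>} \<subseteq> U"
      using testing_nbhd_zero by blast
    then obtain K where K: "\<forall>\<xi>\<in>B. pnorm p \<xi> \<le> K" using K by blast
    \<comment> \<open>The choice gives r \<epsilon> = |K| + 1, strictly above K, and keeps r
      positive whatever the sign of K.\<close>
    define r where "r = (\<bar>K\<bar> + 1) / \<epsilon>"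
    have r: "r > 0" using p by (simp add: r_def)
    have "\<xi> \<in> (\<lambda>\<xi> \<omega>. complex_of_real r * \<xi> \<omega>) ` U" if "\<xi> \<in> B" for \<xi>
    proof
      let ?\<eta> = "\<lambda>\<omega>. complex_of_real (1 / r) * \<xi> \<omega>"
      show "\<xi> = (\<lambda>\<omega>. complex_of_real r * ?\<eta> \<omega>)"
        using r by (auto simp: fun_eq_iff)
      have "pnorm p \<xi> < r * \<epsilon>"
        using K that p by (fastforce simp: r_def)
      then have "pnorm p ?\<eta> < \<epsilon>"
        using r unfolding pnorm_scale by (simp add: norm_divide field_simps)
      moreover have "?\<eta> \<in> testing"
        using that B by (intro testing_scale) auto
      ultimately show "?\<eta> \<in> U" using U by blast
    qed
    with r show "\<exists>r>0. B \<subseteq> (\<lambda>\<xi> \<omega>. complex_of_real r * \<xi> \<omega>) ` U" by blast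
  qed
qed

section \<open>Generalized functionals and strong convergence\<close>

lemma gen_functional_add:
  "\<Phi> \<in> gen_functionals P M \<Longrightarrow> \<xi> \<in> testing \<Longrightarrow> \<eta> \<in> testing \<Longrightarrow> \<Phi> (\<lambda>\<omega>. \<xi> \<omega> + \<eta> \<omega>) = \<Phi> \<xi> + \<Phi> \<eta>"
  and gen_functional_scale:
  "\<Phi> \<in> gen_functionals P M \<Longrightarrow> \<xi> \<in> testing \<Longrightarrow> \<Phi> (\<lambda>\<omega>. c * \<xi> \<omega>) = c * \<Phi> \<xi>"
  by (simp_all add: gen_functionals_def)

lemma gen_functional_zero:
  assumes "\<Phi> \<in> gen_functionals P M"
  shows "\<Phi> (\<lambda>\<omega>. 0) = 0"
  using gen_functional_scale [OF assms testing_zero, of 0] by simp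

lemma gen_functional_sum:
  assumes \<Phi>: "\<Phi> \<in> gen_functionals P M" and "finite A" "A \<subseteq> \<Gamma>"
  shows "\<Phi> (\<lambda>\<omega>. \<Sum>\<sigma>\<in>A. c \<sigma> * noise_prod M \<sigma> \<omega>) = (\<Sum>\<sigma>\<in>A. c \<sigma> * fock_transform M \<Phi> \<sigma>)"
  using assms(2,3)
proof (induction A)
  case empty
  then show ?case by (simp add: gen_functional_zero \<Phi>)
next
  case (insert \<tau> A)
  then show ?case
    by (simp add: gen_functional_add [OF \<Phi>] gen_functional_scale [OF \<Phi>] testing_sum
        testing_scale testing_noise_prod fock_transform_def)
qed

text \<open>Continuity at zero gives a ball of one seminorm on which the functional stays below 1 in
  modulus; homogeneity extends this to an estimate on the whole space.\<close>

lemma gen_functional_bounded: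
  assumes \<Phi>: "\<Phi> \<in> gen_functionals P M"
  shows "\<exists>p\<ge>0. \<exists>C\<ge>0. \<forall>\<xi>\<in>testing. cmod (\<Phi> \<xi>) \<le> C * pnorm p \<xi>"
proof -
  let ?U = "{f \<in> topspace (testing_topology P M). \<Phi> f \<in> ball 0 1}"
  have "openin (testing_topology P M) ?U"
    using \<Phi> by (intro openin_continuous_map_preimage [of _ euclidean]) (auto simp: gen_functionals_def)
  moreover have "(\<lambda>\<omega>. 0) \<in> ?U"
    using openin_subset [OF openin_testing_ball [of 0 1]] testing_zero
    by (auto simp: gen_functional_zero [OF \<Phi>])
  ultimately obtain p \<epsilon> where p: "p \<ge> 0" and \<epsilon>: "\<epsilon> > 0"
    and U: "{\<eta> \<in> testing. pnorm p \<eta> < \<epsilon>} \<subseteq> ?U"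
    using testing_nbhd_zero by blast
  have "cmod (\<Phi> \<xi>) \<le> 1 / \<epsilon> * pnorm p \<xi>" if \<xi>: "\<xi> \<in> testing" for \<xi>
  proof (rule dense_ge)
    \<comment> \<open>The seminorm of \<xi> may vanish, so \<xi> is divided by an arbitrary t
      strictly above the bound instead of being normalised.\<close>
    fix t assume t: "1 / \<epsilon> * pnorm p \<xi> < t"
    then have t0: "t > 0"
      using \<epsilon> by (smt (verit) divide_nonneg_pos mult_nonneg_nonneg pnorm_nonneg)
    let ?\<eta> = "\<lambda>\<omega>. complex_of_real (1 / t) * \<xi> \<omega>"
    have "pnorm p ?\<eta> < \<epsilon>"
      using t t0 \<epsilon> unfolding pnorm_scale by (simp add: norm_divide field_simps)
    then have "?\<eta> \<in> ?U"
      using U \<xi> testing_scale by blast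
    then have "cmod (\<Phi> ?\<eta>) < 1" by simp
    then show "cmod (\<Phi> \<xi>) \<le> t"
      using t0 unfolding gen_functional_scale [OF \<Phi> \<xi>] by (simp add: norm_mult norm_divide field_simps)
  qed
  moreover have "1 / \<epsilon> \<ge> 0" using \<epsilon> by simp
  ultimately show ?thesis using p by blast
qed

text \<open>The functional is dominated by one seminorm, in which the truncated expansions converge
  to \<xi>; on each truncation linearity gives the partial sum.\<close>

lemma gen_functional_expansion:
  assumes \<Phi>: "\<Phi> \<in> gen_functionals P M" and \<xi>: "\<xi> \<in> testing"
  shows "((\<lambda>\<sigma>. coef \<sigma> \<xi> * fock_transform M \<Phi> \<sigma>) has_sum \<Phi> \<xi>) \<Gamma>"
  unfolding has_sum_def
proof (rule Lim_null [THEN iffD2])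
  obtain p C where C: "p \<ge> 0" "C \<ge> 0" "\<And>\<xi>. \<xi> \<in> testing \<Longrightarrow> cmod (\<Phi> \<xi>) \<le> C * pnorm p \<xi>"
    using gen_functional_bounded [OF \<Phi>] by blast
  let ?s = "\<lambda>A \<omega>. \<Sum>\<sigma>\<in>A. coef \<sigma> \<xi> * noise_prod M \<sigma> \<omega>"
  have bound: "cmod ((\<Sum>\<sigma>\<in>A. coef \<sigma> \<xi> * fock_transform M \<Phi> \<sigma>) - \<Phi> \<xi>)
      \<le> C * pnorm p (\<lambda>\<omega>. \<xi> \<omega> - ?s A \<omega>)" if A: "finite A" "A \<subseteq> \<Gamma>" for A
  proof -
    have "\<Phi> (\<lambda>\<omega>. (\<xi> \<omega> - ?s A \<omega>) + ?s A \<omega>) = \<Phi> (\<lambda>\<omega>. \<xi> \<omega> - ?s A \<omega>) + \<Phi> (?s A)"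
      using A by (intro gen_functional_add \<Phi> testing_diff testing_sum \<xi>)
    then have "\<Phi> \<xi> - (\<Sum>\<sigma>\<in>A. coef \<sigma> \<xi> * fock_transform M \<Phi> \<sigma>) = \<Phi> (\<lambda>\<omega>. \<xi> \<omega> - ?s A \<omega>)"
      using A by (simp add: gen_functional_sum [OF \<Phi>])
    then show ?thesis
      by (subst norm_minus_commute) (simp only: C(3) [OF testing_diff [OF \<xi> testing_sum [OF A]]])
  qed
  show "((\<lambda>A. (\<Sum>\<sigma>\<in>A. coef \<sigma> \<xi> * fock_transform M \<Phi> \<sigma>) - \<Phi> \<xi>) \<longlongrightarrow> 0) (finite_subsets_at_top \<Gamma>)"
  proof (rule Lim_null_comparison)
    show "\<forall>\<^sub>F A in finite_subsets_at_top \<Gamma>.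
        cmod ((\<Sum>\<sigma>\<in>A. coef \<sigma> \<xi> * fock_transform M \<Phi> \<sigma>) - \<Phi> \<xi>) \<le> C * pnorm p (\<lambda>\<omega>. \<xi> \<omega> - ?s A \<omega>)"
      using bound by (rule eventually_finite_subsets_at_top_weakI)
    show "((\<lambda>A. C * pnorm p (\<lambda>\<omega>. \<xi> \<omega> - ?s A \<omega>)) \<longlongrightarrow> 0) (finite_subsets_at_top \<Gamma>)"
      using tendsto_mult_right_zero [OF pnorm_truncation_tendsto [OF \<xi>]] .
  qed
qed

lemma gen_functional_bounded_on:
  assumes "\<Phi> \<in> gen_functionals P M" "testing_bounded P M B"
  shows "\<exists>K\<ge>0. \<forall>\<xi>\<in>B. cmod (\<Phi> \<xi>) \<le> K"
proof -
  obtain p C where C: "p \<ge> 0" "C \<ge> 0" "\<And>\<xi>. \<xi> \<in> testing \<Longrightarrow> cmod (\<Phi> \<xi>) \<le> C * pnorm p \<xi>"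
    using gen_functional_bounded [OF assms(1)] by blast
  obtain K where K: "B \<subseteq> testing" "\<forall>\<xi>\<in>B. pnorm p \<xi> \<le> K"
    using assms(2) C(1) by (auto simp: testing_bounded_iff)
  have "cmod (\<Phi> \<xi>) \<le> C * \<bar>K\<bar>" if "\<xi> \<in> B" for \<xi>
  proof -
    have "cmod (\<Phi> \<xi>) \<le> C * pnorm p \<xi>" using that C(3) K(1) by blast
    also have "\<dots> \<le> C * \<bar>K\<bar>" using that K(2) C(2) by (intro mult_left_mono) auto
    finally show ?thesis .
  qed
  then show ?thesis using C(2) by (intro exI [of _ "C * \<bar>K\<bar>"]) auto
qed

text \<open>The singleton of a noise product is a bounded set.\<close>

lemma fock_transform_tendsto:
  assumes "converges_strongly P M \<Phi>s \<Phi>" "finite \<sigma>"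
  shows "(\<lambda>n. fock_transform M (\<Phi>s n) \<sigma>) \<longlonglongrightarrow> fock_transform M \<Phi> \<sigma>"
proof -
  have "testing_bounded P M {noise_prod M \<sigma>}"
    using assms(2) by (auto simp: testing_bounded_iff testing_noise_prod)
  with assms(1) have "uniform_limit {noise_prod M \<sigma>} \<Phi>s \<Phi> sequentially"
    unfolding converges_strongly_def by blast
  then show ?thesis
    unfolding fock_transform_def by (rule tendsto_uniform_limitI) simp
qed

text \<open>If no bound holds, there are \<open>\<sigma> k\<close> and \<open>n k\<close> violating it for \<open>C = p = k\<close>; the rescaled vectors
  \<open>\<lambda>\<^bsub>\<sigma> k\<^esub>\<^sup>-\<^sup>k Z\<^bsub>\<sigma> k\<^esub>\<close> form a bounded set on which the functionals are unbounded.\<close>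

lemma fock_transform_uniformly_bounded:
  assumes conv: "converges_strongly P M \<Phi>s \<Phi>" and \<Phi>: "\<Phi> \<in> gen_functionals P M"
    and \<Phi>s: "\<And>n. n \<ge> 1 \<Longrightarrow> \<Phi>s n \<in> gen_functionals P M"
  shows "\<exists>C\<ge>0. \<exists>p\<ge>0. \<forall>\<sigma>\<in>\<Gamma>. \<forall>n\<ge>1. cmod (fock_transform M (\<Phi>s n) \<sigma>) \<le> C * weight \<sigma> powr p"
proof (rule ccontr)
  assume neg: "\<not> ?thesis"
  have "\<exists>\<sigma> n. finite \<sigma> \<and> n \<ge> 1 \<and> real k * weight \<sigma> powr real k < cmod (fock_transform M (\<Phi>s n) \<sigma>)"
    for k :: nat
  proof -
    have "\<not> (\<forall>\<sigma>\<in>\<Gamma>. \<forall>n\<ge>1. cmod (fock_transform M (\<Phi>s n) \<sigma>) \<le> real k * weight \<sigma> powr real k)"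
      using neg of_nat_0_le_iff [of k] by blast
    then show ?thesis unfolding not_le [symmetric] mem_Collect_eq by blast
  qed
  then obtain \<sigma> n where fin: "\<And>k. finite (\<sigma> k)" and n: "\<And>k. n k \<ge> 1"
    and big: "\<And>k::nat. real k * weight (\<sigma> k) powr real k < cmod (fock_transform M (\<Phi>s (n k)) (\<sigma> k))"
    by metis
  define b where "b k = (\<lambda>\<omega>. complex_of_real (weight (\<sigma> k) powr - real k) * noise_prod M (\<sigma> k) \<omega>)" for k
  have b_norm: "pnorm p (b k) = weight (\<sigma> k) powr (p - real k)" for p k
    by (simp add: b_def pnorm_scale pnorm_noise_prod fin flip: powr_add)
  have B: "testing_bounded P M (range b)"
    unfolding testing_bounded_iff
  proof (intro conjI allI impI)
    show "range b \<subseteq> testing"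
      by (auto simp: b_def intro!: testing_scale testing_noise_prod fin)
    fix p :: real assume "p \<ge> 0"
    obtain m :: nat where m: "p \<le> real m" using real_arch_simple by blast
    \<comment> \<open>For k \<ge> m the exponent p - k is at most 0, so the norm is at most 1; the
      sum takes care of the finitely many k < m.\<close>
    have "pnorm p (b k) \<le> 1 + (\<Sum>j<m. weight (\<sigma> j) powr (p - real j))" for k
    proof (cases "k < m")
      case True
      then have "weight (\<sigma> k) powr (p - real k) \<le> (\<Sum>j<m. weight (\<sigma> j) powr (p - real j))"
        by (intro member_le_sum) auto
      then show ?thesis by (simp add: b_norm)
    next
      case False
      with m have "weight (\<sigma> k) powr (p - real k) \<le> weight (\<sigma> k) powr 0"
        by (intro powr_mono weight_ge_1) simp
      then have "pnorm p (b k) \<le> 1" by (simp add: b_norm)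
      then show ?thesis
        by (rule order_trans) (simp add: sum_nonneg)
    qed
    then show "\<exists>K. \<forall>\<xi>\<in>range b. pnorm p \<xi> \<le> K" by blast
  qed
  have "\<forall>\<^sub>F j in sequentially. \<forall>\<xi>\<in>range b. dist (\<Phi>s j \<xi>) (\<Phi> \<xi>) < 1"
    using conv B unfolding converges_strongly_def by (intro uniform_limitD) simp_all
  then obtain N where N: "\<And>j \<xi>. j \<ge> N \<Longrightarrow> \<xi> \<in> range b \<Longrightarrow> dist (\<Phi>s j \<xi>) (\<Phi> \<xi>) < 1"
    unfolding eventually_sequentially by blast
  obtain L where L: "L \<ge> 0" "\<And>\<xi>. \<xi> \<in> range b \<Longrightarrow> cmod (\<Phi> \<xi>) \<le> L"
    using gen_functional_bounded_on [OF \<Phi> B] by blast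
  \<comment> \<open>The condition j \<ge> 1 stands inside the existential so that K can be chosen
    for every j, including 0, where nothing is assumed about \<open>\<Phi>s\<close>.\<close>
  have "\<forall>j. \<exists>K\<ge>0. j \<ge> 1 \<longrightarrow> (\<forall>\<xi>\<in>range b. cmod (\<Phi>s j \<xi>) \<le> K)"
    using gen_functional_bounded_on [OF \<Phi>s B] by (metis order_refl)
  then obtain K where K: "\<And>j. K j \<ge> 0" "\<And>j \<xi>. j \<ge> 1 \<Longrightarrow> \<xi> \<in> range b \<Longrightarrow> cmod (\<Phi>s j \<xi>) \<le> K j"
    by metis
  \<comment> \<open>From N on, the functionals lie within 1 of the limit, which is bounded by L on
    the set; the earlier ones have their own bounds \<open>K i\<close>.\<close>
  have bound: "cmod (\<Phi>s j \<xi>) \<le> 1 + L + (\<Sum>i<N. K i)" if "j \<ge> 1" "\<xi> \<in> range b" for j \<xi>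
  proof (cases "j < N")
    case True
    then have "K j \<le> (\<Sum>i<N. K i)"
      using K(1) by (intro member_le_sum) auto
    with K(2) [OF that] L(1) show ?thesis by linarith
  next
    case False
    have "cmod (\<Phi>s j \<xi>) \<le> dist (\<Phi>s j \<xi>) (\<Phi> \<xi>) + cmod (\<Phi> \<xi>)"
      using norm_triangle_sub [of "\<Phi>s j \<xi>" "\<Phi> \<xi>"] by (simp add: dist_norm)
    moreover have "(\<Sum>i<N. K i) \<ge> 0" using K(1) by (intro sum_nonneg) auto
    ultimately show ?thesis
      using N [of j \<xi>] L(2) [of \<xi>] False that by simp
  qed
  \<comment> \<open>With k beyond the common bound, the choice of \<open>\<sigma> k\<close> and
    \<open>n k\<close> makes the value at \<open>b k\<close> exceed k.\<close>
  obtain k :: nat where k: "1 + L + (\<Sum>i<N. K i) < real k"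
    using reals_Archimedean2 by blast
  have "cmod (\<Phi>s (n k) (b k)) = weight (\<sigma> k) powr - real k * cmod (fock_transform M (\<Phi>s (n k)) (\<sigma> k))"
    unfolding b_def
    by (simp add: gen_functional_scale [OF \<Phi>s [OF n]] testing_noise_prod fin norm_mult
        fock_transform_def)
  also have "\<dots> > weight (\<sigma> k) powr - real k * (real k * weight (\<sigma> k) powr real k)"
    using big [of k] by (intro mult_strict_left_mono) auto
  also have "weight (\<sigma> k) powr - real k * (real k * weight (\<sigma> k) powr real k) = real k"
    by (simp add: powr_minus)
  finally show False
    using bound [OF n, of "b k" k] k by simp
qed

text \<open>In each term of the expansion the weight to the power p + 2 goes to the coefficient,
  which is then bounded on B, and its inverse to the difference of the Fock transforms: p absorbs
  their growth, and the remaining power -2 is summable.\<close>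

lemma converges_strongly_if_fock_transform_bounded:
  assumes \<Phi>: "\<Phi> \<in> gen_functionals P M" and \<Phi>s: "\<And>n. n \<ge> 1 \<Longrightarrow> \<Phi>s n \<in> gen_functionals P M"
    and lim: "\<And>\<sigma>. finite \<sigma> \<Longrightarrow> (\<lambda>n. fock_transform M (\<Phi>s n) \<sigma>) \<longlonglongrightarrow> fock_transform M \<Phi> \<sigma>"
    and bound: "\<And>\<sigma> n. finite \<sigma> \<Longrightarrow> n \<ge> 1 \<Longrightarrow> cmod (fock_transform M (\<Phi>s n) \<sigma>) \<le> C * weight \<sigma> powr p"
    and p: "p \<ge> 0"
  shows "converges_strongly P M \<Phi>s \<Phi>"
  unfolding converges_strongly_def
proof (intro allI impI uniform_limitI)
  fix B and \<epsilon> :: real assume bdd: "testing_bounded P M B" and \<epsilon>: "\<epsilon> > 0"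
  have "p + 2 \<ge> 0" using p by simp
  with bdd obtain K where B: "B \<subseteq> testing" and K: "\<And>\<xi>. \<xi> \<in> B \<Longrightarrow> pnorm (p + 2) \<xi> \<le> K"
    unfolding testing_bounded_iff by blast
  define d where "d n \<sigma> = fock_transform M (\<Phi>s n) \<sigma> - fock_transform M \<Phi> \<sigma>" for n \<sigma>
  define e where "e n \<sigma> = weight \<sigma> powr - (p + 2) * cmod (d n \<sigma>)" for n \<sigma>
  define g where "g \<sigma> = 2 * C * weight \<sigma> powr - 2" for \<sigma>
  have g: "g summable_on \<Gamma>"
    unfolding g_def by (intro summable_on_cmult_right weight_summable)
  have eg: "e n \<sigma> \<le> g \<sigma>" if "finite \<sigma>" "n \<ge> 1" for n \<sigma>
  proof -
    \<comment> \<open>The limit inherits the bound, so the difference costs the factor 2 in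
      \<open>g\<close>.\<close>
    have "cmod (fock_transform M \<Phi> \<sigma>) \<le> C * weight \<sigma> powr p"
      by (rule LIMSEQ_le_const2 [OF tendsto_norm [OF lim [OF that(1)]]]) (use bound that in blast)
    then have "cmod (d n \<sigma>) \<le> 2 * C * weight \<sigma> powr p"
      using bound [OF that] norm_triangle_ineq4 [of "fock_transform M (\<Phi>s n) \<sigma>" "fock_transform M \<Phi> \<sigma>"]
      by (simp add: d_def)
    then have "e n \<sigma> \<le> weight \<sigma> powr - (p + 2) * (2 * C * weight \<sigma> powr p)"
      unfolding e_def by (intro mult_left_mono) auto
    also have "\<dots> = 2 * C * (weight \<sigma> powr - (p + 2) * weight \<sigma> powr p)"
      by simp
    also have "\<dots> = g \<sigma>"
      by (simp add: g_def flip: powr_add)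
    finally show ?thesis .
  qed
  have e0: "e n \<sigma> \<ge> 0" for n \<sigma>
    by (simp add: e_def)
  have "(\<lambda>n. infsum (e n) \<Gamma>) \<longlonglongrightarrow> 0"
  proof (rule tendsto_infsum_dominated [OF g])
    fix \<sigma> :: "nat set" assume "\<sigma> \<in> \<Gamma>"
    then have "(\<lambda>n. d n \<sigma>) \<longlonglongrightarrow> 0"
      using lim [of \<sigma>] by (simp add: d_def LIM_zero)
    then show "(\<lambda>n. e n \<sigma>) \<longlonglongrightarrow> 0"
      unfolding e_def by (intro tendsto_mult_right_zero tendsto_norm_zero)
  next
    show "\<forall>\<^sub>F n in sequentially. \<forall>\<sigma>\<in>\<Gamma>. e n \<sigma> \<le> g \<sigma>"
      unfolding eventually_sequentially using eg by blast
  qed (rule e0)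
  then have "(\<lambda>n. K * infsum (e n) \<Gamma>) \<longlonglongrightarrow> 0"
    by (rule tendsto_mult_right_zero)
  then have "\<forall>\<^sub>F n in sequentially. K * infsum (e n) \<Gamma> < \<epsilon>"
    using \<epsilon> by (rule order_tendstoD)
  then show "\<forall>\<^sub>F n in sequentially. \<forall>\<xi>\<in>B. dist (\<Phi>s n \<xi>) (\<Phi> \<xi>) < \<epsilon>"
    \<comment> \<open>The hypotheses on \<open>\<Phi>s\<close> start at index 1.\<close>
    using eventually_ge_at_top [of 1]
  proof eventually_elim
    case (elim n)
    have e_sum: "e n summable_on \<Gamma>"
      using eg [OF _ elim(2)] e0 by (intro summable_on_comparison_test [OF g]) auto
    show ?case
    proof
      fix \<xi> assume \<xi>: "\<xi> \<in> B"
      have "\<xi> \<in> testing" using \<xi> B by blast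
      \<comment> \<open>Both functionals are expanded along the same coefficients of \<xi>, so their
        difference is a single sum.\<close>
      then have "((\<lambda>\<sigma>. coef \<sigma> \<xi> * fock_transform M (\<Phi>s n) \<sigma> + - (coef \<sigma> \<xi> * fock_transform M \<Phi> \<sigma>))
          has_sum (\<Phi>s n \<xi> + - \<Phi> \<xi>)) \<Gamma>"
        by (intro has_sum_add has_sum_uminusI gen_functional_expansion \<Phi> \<Phi>s elim)
      then have sum: "((\<lambda>\<sigma>. coef \<sigma> \<xi> * d n \<sigma>) has_sum (\<Phi>s n \<xi> - \<Phi> \<xi>)) \<Gamma>"
        by (simp add: d_def right_diff_distrib)
      have le: "cmod (coef \<sigma> \<xi> * d n \<sigma>) \<le> K * e n \<sigma>" if "finite \<sigma>" for \<sigma>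
      proof -
        have "weight \<sigma> powr (p + 2) * weight \<sigma> powr - (p + 2) = 1"
          by (simp flip: powr_add)
        then have "cmod (coef \<sigma> \<xi> * d n \<sigma>)
            = (weight \<sigma> powr (p + 2) * weight \<sigma> powr - (p + 2)) * (cmod (coef \<sigma> \<xi>) * cmod (d n \<sigma>))"
          by (simp add: norm_mult)
        also have "\<dots> = wcoef (p + 2) \<xi> \<sigma> * e n \<sigma>"
          by (simp add: wcoef_def e_def)
        also have "wcoef (p + 2) \<xi> \<sigma> \<le> K"
          using wcoef_le_pnorm [of \<xi> \<sigma> "p + 2"] K [OF \<xi>] \<xi> B that by fastforce
        finally show ?thesis using e0 by (simp add: mult_right_mono)
      qed
      have Ke: "(\<lambda>\<sigma>. K * e n \<sigma>) summable_on \<Gamma>"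
        by (intro summable_on_cmult_right e_sum)
      then have abs: "(\<lambda>\<sigma>. cmod (coef \<sigma> \<xi> * d n \<sigma>)) summable_on \<Gamma>"
        by (rule summable_on_comparison_test) (use le in auto)
      have "cmod (\<Phi>s n \<xi> - \<Phi> \<xi>) \<le> (\<Sum>\<^sub>\<infinity>\<sigma>\<in>\<Gamma>. cmod (coef \<sigma> \<xi> * d n \<sigma>))"
        using norm_has_sum_bound [OF has_sum_infsum [OF abs] sum] .
      also have "\<dots> \<le> (\<Sum>\<^sub>\<infinity>\<sigma>\<in>\<Gamma>. K * e n \<sigma>)"
        using abs Ke le by (intro infsum_mono) auto
      \<comment> \<open>This bound no longer involves \<xi>, which makes the convergence uniform on
        B.\<close>
      also have "\<dots> = K * infsum (e n) \<Gamma>"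
        by (rule infsum_cmult_right')
      finally show "dist (\<Phi>s n \<xi>) (\<Phi> \<xi>) < \<epsilon>"
        using elim by (simp add: dist_norm)
    qed
  qed
qed

end

theorem theorem3p2:
  fixes P :: "'a measure"
    and M :: "nat \<Rightarrow> 'a \<Rightarrow> real"
    and \<Phi> :: "('a \<Rightarrow> complex) \<Rightarrow> complex"
    and \<Phi>s :: "nat \<Rightarrow> ('a \<Rightarrow> complex) \<Rightarrow> complex"
  assumes "prob_space P"
    and "normal_martingale P M"
    and "chaotic_representation P M"
    and "\<Phi> \<in> gen_functionals P M"
    and "\<And>n. n \<ge> 1 \<Longrightarrow> \<Phi>s n \<in> gen_functionals P M"
  shows "converges_strongly P M \<Phi>s \<Phi> \<longleftrightarrow>
    (\<forall>\<sigma>\<in>\<Gamma>. (\<lambda>n. fock_transform M (\<Phi>s n) \<sigma>) \<longlonglongrightarrow> fock_transform M \<Phi> \<sigma>) \<and>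
    (\<exists>C p :: real. C \<ge> 0 \<and> p \<ge> 0 \<and>
       (\<forall>\<sigma>\<in>\<Gamma>. (SUP n\<in>{1..}. ereal (cmod (fock_transform M (\<Phi>s n) \<sigma>)))
                  \<le> ereal (C * weight \<sigma> powr p)))"
proof -
  interpret normal_martingale_space P M
    using assms(1,2) by (intro normal_martingale_space.intro normal_martingale_space_axioms.intro)
  note \<Phi> = assms(4) and \<Phi>s = assms(5)
  \<comment> \<open>In the complete lattice \<open>ereal\<close> the supremum always exists, so a
    real bound on it is the same as a bound on every term.\<close>
  have sup: "(SUP n\<in>{1..}. ereal (cmod (fock_transform M (\<Phi>s n) \<sigma>))) \<le> ereal r
      \<longleftrightarrow> (\<forall>n\<ge>1. cmod (fock_transform M (\<Phi>s n) \<sigma>) \<le> r)" for \<sigma> r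
    by (auto simp: SUP_le_iff)
  show ?thesis
    unfolding sup
  proof (intro iffI conjI ballI)
    fix \<sigma> :: "nat set" assume "converges_strongly P M \<Phi>s \<Phi>" "\<sigma> \<in> \<Gamma>"
    then show "(\<lambda>n. fock_transform M (\<Phi>s n) \<sigma>) \<longlonglongrightarrow> fock_transform M \<Phi> \<sigma>"
      by (simp add: fock_transform_tendsto)
  next
    assume "converges_strongly P M \<Phi>s \<Phi>"
    from fock_transform_uniformly_bounded [OF this \<Phi> \<Phi>s]
    show "\<exists>C p. C \<ge> 0 \<and> p \<ge> 0 \<and> (\<forall>\<sigma>\<in>\<Gamma>. \<forall>n\<ge>1. cmod (fock_transform M (\<Phi>s n) \<sigma>) \<le> C * weight \<sigma> powr p)"
      by blast
  next
    assume "(\<forall>\<sigma>\<in>\<Gamma>. (\<lambda>n. fock_transform M (\<Phi>s n) \<sigma>) \<longlonglongrightarrow> fock_transform M \<Phi> \<sigma>) \<and>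
      (\<exists>C p. C \<ge> 0 \<and> p \<ge> 0 \<and> (\<forall>\<sigma>\<in>\<Gamma>. \<forall>n\<ge>1. cmod (fock_transform M (\<Phi>s n) \<sigma>) \<le> C * weight \<sigma> powr p))"
    then obtain C p where "p \<ge> 0"
      and "\<And>\<sigma>. finite \<sigma> \<Longrightarrow> (\<lambda>n. fock_transform M (\<Phi>s n) \<sigma>) \<longlonglongrightarrow> fock_transform M \<Phi> \<sigma>"
      and "\<And>\<sigma> n. finite \<sigma> \<Longrightarrow> n \<ge> 1 \<Longrightarrow> cmod (fock_transform M (\<Phi>s n) \<sigma>) \<le> C * weight \<sigma> powr p"
      by blast
    with \<Phi> \<Phi>s show "converges_strongly P M \<Phi>s \<Phi>"
      by (intro converges_strongly_if_fock_transform_bounded)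
  qed
qed

end
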